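(* For each $i\in[4]$, the subgroup $L_i$ of $\mathrm{Aut}(\mathcal{O}_4)$ is contained in $\lambda^{-1}(\mathcal{P}_4^2)$ and is isomorphic to $(\mathbb{Z}_3^{\times3})\rtimes\mathbb{Z}_2$ (a semidirect product for some action of $\mathbb{Z}_2$ on $\mathbb{Z}_3^{\times 3}$). The kernel of the restriction to $L_i$ of the canonical projection, $\pi:L_i\to\mathrm{Out}(\mathcal{O}_4)$, is trivial, and the $4$ groups $\pi(L_i)$, $i\in[4]$, are mutually distinct.
   Context: $[n]=\{1,\dots,n\}$; $S(A)$ is the symmetric group on $A$, $S_n=S([n])$; permutations are in disjoint cycle form, composed right to left. For $u\in S([n]^t)$, $v\in S([n]^r)$, $u\otimes v\in S([n]^{t+r})$ is $(u\otimes v)(\alpha,\beta)=(u(\alpha),v(\beta))$; $1$ is the identity of $S_n$. The Cuntz algebra $\mathcal{O}_n$ ($n\ge2$) is the universal $C^*$-algebra generated by isometries $S_1,\dots,S_n$ with $\sum_iS_iS_i^*=1$. For a unitary $u\in\mathcal{O}_n$, $\lambda_u$ is the unique unital $*$-endomorphism of $\mathcal{O}_n$ with $\lambda_u(S_i)=uS_i$ for all $i$. A permutation $u\in S([n]^t)$ is identified with the unitary $\sum_{\alpha\in[n]^t}S_{u(\alpha)}S_\alpha^*$, where $S_\alpha=S_{\alpha_1}\cdots S_{\alpha_t}$; $\mathcal{P}_n^t$ is the set of these unitaries, and $\lambda_u$ for a permutation $u$ means $\lambda$ of the corresponding unitary. $\lambda^{-1}(\mathcal{P}_n^2):=\{\lambda_u\in\mathrm{Aut}(\mathcal{O}_n):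 u\in\mathcal{P}_n^2\}$. $\mathrm{Out}(\mathcal{O}_n)$ is the quotient of $\mathrm{Aut}(\mathcal{O}_n)$ by inner automorphisms and $\pi$ is the canonical projection. For $i\in[4]$ let $(b_1,b_2,b_3)\in S_4$ be any $3$-cycle with $\{b_1,b_2,b_3\}=[4]\setminus\{i\}$ (with any fixed way of writing it). Define in $S([4]^2)$: $a=((i,b_1),(i,b_2),(i,b_3))$, $b=((b_1,i),(b_2,i),(b_3,i))$, $c=\prod_{x\neq i}((x,b_1),(x,b_2),(x,b_3))$, and $t=(b_1,b_3)\in S_4$. $L_i$ is the subgroup of $\mathrm{Aut}(\mathcal{O}_4)$ generated by $\lambda_a,\lambda_b,\lambda_c,\lambda_{t\otimes1}$; its image in $\mathrm{Out}(\mathcal{O}_4)$ does not depend on the choices made. *)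

theory Defs
  imports Complex_Main "HOL-Algebra.Algebra" "HOL-Combinatorics.Cycles"
begin

section \<open>Unital C*-algebras\<close>

definition complex_field :: "complex ring"
  where "complex_field = \<lparr>carrier = UNIV, monoid.mult = (*), one = 1, ring.zero = 0, ring.add = (+)\<rparr>"

record 'a cstar = "(complex, 'a) module" +
  star :: "'a \<Rightarrow> 'a"
  nrm :: "'a \<Rightarrow> real"

text \<open>Unital C*-algebras are taken to be nonzero (axiom \<open>one_not_zero\<close>), as usual.\<close>

locale cstar_algebra = ring A + module complex_field A for A :: "('a, 'b) cstar_scheme" (structure) +
  assumes one_not_zero: "\<one> \<noteq> \<zero>"
    and smult_mult_left:
      "\<lbrakk>x \<in> carrier A; y \<in> carrier A\<rbrakk> \<Longrightarrow> (c \<odot> x) \<otimes> y = c \<odot> (x \<otimes> y)"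
    and smult_mult_right:
      "\<lbrakk>x \<in> carrier A; y \<in> carrier A\<rbrakk> \<Longrightarrow> x \<otimes> (c \<odot> y) = c \<odot> (x \<otimes> y)"
    and star_closed: "x \<in> carrier A \<Longrightarrow> star A x \<in> carrier A"
    and star_star: "x \<in> carrier A \<Longrightarrow> star A (star A x) = x"
    and star_add:
      "\<lbrakk>x \<in> carrier A; y \<in> carrier A\<rbrakk> \<Longrightarrow> star A (x \<oplus> y) = star A x \<oplus> star A y"
    and star_smult: "x \<in> carrier A \<Longrightarrow> star A (c \<odot> x) = cnj c \<odot> star A x"
    and star_mult:
      "\<lbrakk>x \<in> carrier A; y \<in> carrier A\<rbrakk> \<Longrightarrow> star A (x \<otimes> y) = star A y \<otimes> star A x"
    and nrm_nonneg: "x \<in> carrier A \<Longrightarrow> 0 \<le> nrm A x"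
    and nrm_eq_zero: "x \<in> carrier A \<Longrightarrow> nrm A x = 0 \<longleftrightarrow> x = \<zero>"
    and nrm_triangle:
      "\<lbrakk>x \<in> carrier A; y \<in> carrier A\<rbrakk> \<Longrightarrow> nrm A (x \<oplus> y) \<le> nrm A x + nrm A y"
    and nrm_smult: "x \<in> carrier A \<Longrightarrow> nrm A (c \<odot> x) = cmod c * nrm A x"
    and nrm_mult:
      "\<lbrakk>x \<in> carrier A; y \<in> carrier A\<rbrakk> \<Longrightarrow> nrm A (x \<otimes> y) \<le> nrm A x * nrm A y"
    and cstar_identity: "x \<in> carrier A \<Longrightarrow> nrm A (star A x \<otimes> x) = (nrm A x)\<^sup>2"
    and complete:
      "\<lbrakk>\<And>k. f k \<in> carrier A;
        \<And>e. e > 0 \<Longrightarrow> \<exists>N::nat. \<forall>j\<ge>N. \<forall>k\<ge>N. nrm A (f j \<ominus> f k) < e\<rbrakk>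
       \<Longrightarrow> \<exists>l\<in>carrier A. (\<lambda>k. nrm A (f k \<ominus> l)) \<longlonglongrightarrow> 0"

text \<open>Unital *-homomorphisms. As in \<^const>\<open>Bij\<close>, functions are required to be extensional,
  so that equality of functions is equality on the carrier.\<close>

definition star_hom :: "('a, 'c) cstar_scheme \<Rightarrow> ('b, 'd) cstar_scheme \<Rightarrow> ('a \<Rightarrow> 'b) set"
  where "star_hom A B = {\<phi> \<in> ring_hom A B \<inter> extensional (carrier A).
    (\<forall>c. \<forall>x\<in>carrier A. \<phi> (c \<odot>\<^bsub>A\<^esub> x) = c \<odot>\<^bsub>B\<^esub> \<phi> x) \<and>
    (\<forall>x\<in>carrier A. \<phi> (star A x) = star B (\<phi> x))}"

definition cstar_Aut :: "('a, 'c) cstar_scheme \<Rightarrow> ('a \<Rightarrow> 'a) monoid"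
  where "cstar_Aut A = BijGroup (carrier A) \<lparr>carrier := star_hom A A \<inter> Bij (carrier A)\<rparr>"

definition unitaries :: "('a, 'c) cstar_scheme \<Rightarrow> 'a set"
  where "unitaries A = {w \<in> carrier A. star A w \<otimes>\<^bsub>A\<^esub> w = \<one>\<^bsub>A\<^esub> \<and> w \<otimes>\<^bsub>A\<^esub> star A w = \<one>\<^bsub>A\<^esub>}"

definition cstar_Inn :: "('a, 'c) cstar_scheme \<Rightarrow> ('a \<Rightarrow> 'a) set"
  where "cstar_Inn A = {(\<lambda>x\<in>carrier A. w \<otimes>\<^bsub>A\<^esub> x \<otimes>\<^bsub>A\<^esub> star A w) | w. w \<in> unitaries A}"

definition cstar_Out :: "('a, 'c) cstar_scheme \<Rightarrow> ('a \<Rightarrow> 'a) set monoid"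
  where "cstar_Out A = cstar_Aut A Mod cstar_Inn A"

definition out_proj :: "('a, 'c) cstar_scheme \<Rightarrow> ('a \<Rightarrow> 'a) \<Rightarrow> ('a \<Rightarrow> 'a) set"
  where "out_proj A \<phi> = cstar_Inn A #>\<^bsub>cstar_Aut A\<^esub> \<phi>"


section \<open>The Cuntz algebra\<close>

definition cuntz_family :: "nat \<Rightarrow> ('a, 'c) cstar_scheme \<Rightarrow> (nat \<Rightarrow> 'a) \<Rightarrow> bool"
  where "cuntz_family n A S \<longleftrightarrow>
    (\<forall>i\<in>{1..n}. S i \<in> carrier A \<and> star A (S i) \<otimes>\<^bsub>A\<^esub> S i = \<one>\<^bsub>A\<^esub>) \<and>
    (\<Oplus>\<^bsub>A\<^esub>i\<in>{1..n}. S i \<otimes>\<^bsub>A\<^esub> star A (S i)) = \<one>\<^bsub>A\<^esub>"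

text \<open>The Cuntz algebra, characterised up to isomorphism by its universal property. A definition
  cannot quantify over types, so the test algebras \<open>B\<close> live on subsets of the same type as \<open>A\<close>.
  This is no restriction: a C*-algebra generated by a Cuntz family is separable, hence has at most
  the cardinality of the continuum, and the type of \<open>A\<close> contains a copy of the scalars because
  \<open>\<one> \<noteq> \<zero>\<close>; so it carries an isomorphic copy of every C*-algebra generated by a Cuntz family.
  That \<open>A\<close> is generated by \<open>S\<close> is the uniqueness part of the universal property.\<close>

locale cuntz_algebra = cstar_algebra A for n :: nat and A :: "'a cstar" (structure)
    and S :: "nat \<Rightarrow> 'a" +
  assumes two_le: "2 \<le> n"
    and family: "cuntz_family n A S"
    and universal: "\<And>(B :: 'a cstar) T. \<lbrakk>cstar_algebra B; cuntz_family n B T\<rbrakk>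
      \<Longrightarrow> \<exists>!\<phi>. \<phi> \<in> star_hom A B \<and> (\<forall>i\<in>{1..n}. \<phi> (S i) = T i)"

definition cuntz_endo :: "nat \<Rightarrow> ('a, 'c) cstar_scheme \<Rightarrow> (nat \<Rightarrow> 'a) \<Rightarrow> 'a \<Rightarrow> 'a \<Rightarrow> 'a"
  where "cuntz_endo n A S u =
    (THE \<phi>. \<phi> \<in> star_hom A A \<and> (\<forall>i\<in>{1..n}. \<phi> (S i) = u \<otimes>\<^bsub>A\<^esub> S i))"


section \<open>Permutative endomorphisms\<close>

text \<open>\<open>[n]\<^sup>t\<close> is the set of lists of length \<open>t\<close>; in particular \<open>[n]\<close> is identified with the
  one-letter words, and \<open>(x, y) \<in> [n]\<^sup>2\<close> is written \<open>[x, y]\<close>.\<close>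

definition words :: "nat \<Rightarrow> nat \<Rightarrow> nat list set"
  where "words n t = {\<alpha>. set \<alpha> \<subseteq> {1..n} \<and> length \<alpha> = t}"

definition word_isometry :: "('a, 'c) cstar_scheme \<Rightarrow> (nat \<Rightarrow> 'a) \<Rightarrow> nat list \<Rightarrow> 'a"
  where "word_isometry A S \<alpha> = foldr (\<lambda>i x. S i \<otimes>\<^bsub>A\<^esub> x) \<alpha> \<one>\<^bsub>A\<^esub>"

definition perm_unitary ::
  "nat \<Rightarrow> ('a, 'c) cstar_scheme \<Rightarrow> (nat \<Rightarrow> 'a) \<Rightarrow> nat \<Rightarrow> (nat list \<Rightarrow> nat list) \<Rightarrow> 'a"
  where "perm_unitary n A S t u =
    (\<Oplus>\<^bsub>A\<^esub>\<alpha>\<in>words n t. word_isometry A S (u \<alpha>) \<otimes>\<^bsub>A\<^esub> star A (word_isometry A S \<alpha>))"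

definition perm_unitaries :: "nat \<Rightarrow> ('a, 'c) cstar_scheme \<Rightarrow> (nat \<Rightarrow> 'a) \<Rightarrow> nat \<Rightarrow> 'a set"
  where "perm_unitaries n A S t = {perm_unitary n A S t u | u. u permutes words n t}"

definition perm_endo ::
  "nat \<Rightarrow> ('a, 'c) cstar_scheme \<Rightarrow> (nat \<Rightarrow> 'a) \<Rightarrow> nat \<Rightarrow> (nat list \<Rightarrow> nat list) \<Rightarrow> 'a \<Rightarrow> 'a"
  where "perm_endo n A S t u = cuntz_endo n A S (perm_unitary n A S t u)"

text \<open>The set \<open>\<lambda>\<^sup>-\<^sup>1(\<P>\<^sub>n\<^sup>t)\<close>.\<close>

definition perm_auts :: "nat \<Rightarrow> ('a, 'c) cstar_scheme \<Rightarrow> (nat \<Rightarrow> 'a) \<Rightarrow> nat \<Rightarrow> ('a \<Rightarrow> 'a) set"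
  where "perm_auts n A S t = cuntz_endo n A S ` perm_unitaries n A S t \<inter> carrier (cstar_Aut A)"

text \<open>\<open>u \<otimes> v\<close> for \<open>u \<in> S([n]\<^sup>t)\<close> and \<open>v \<in> S([n]\<^sup>r)\<close>.\<close>

definition perm_tensor :: "nat \<Rightarrow> nat \<Rightarrow> nat \<Rightarrow> (nat list \<Rightarrow> nat list) \<Rightarrow> (nat list \<Rightarrow> nat list) \<Rightarrow>
    nat list \<Rightarrow> nat list"
  where "perm_tensor n t r u v \<alpha> =
    (if \<alpha> \<in> words n (t + r) then u (take t \<alpha>) @ v (drop t \<alpha>) else \<alpha>)"


section \<open>The groups \<open>L\<^sub>i\<close>\<close>

text \<open>\<open>cycle_of_list [x\<^sub>1, \<dots>, x\<^sub>k]\<close> is the cycle \<open>x\<^sub>1 \<mapsto> x\<^sub>2 \<mapsto> \<dots> \<mapsto> x\<^sub>k \<mapsto> x\<^sub>1\<close>. The triple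
  \<open>(b\<^sub>1, b\<^sub>2, b\<^sub>3)\<close> is a 3-cycle together with a way of writing it.\<close>

definition admissible :: "nat \<Rightarrow> nat \<times> nat \<times> nat \<Rightarrow> bool"
  where "admissible i = (\<lambda>(b1, b2, b3). distinct [b1, b2, b3] \<and> {b1, b2, b3} = {1..4} - {i})"

definition row_cycle :: "nat \<Rightarrow> nat \<times> nat \<times> nat \<Rightarrow> nat list \<Rightarrow> nat list"
  where "row_cycle x = (\<lambda>(b1, b2, b3). cycle_of_list [[x, b1], [x, b2], [x, b3]])"

definition perm_a :: "nat \<Rightarrow> nat \<times> nat \<times> nat \<Rightarrow> nat list \<Rightarrow> nat list"
  where "perm_a i b = row_cycle i b"

definition perm_b :: "nat \<Rightarrow> nat \<times> nat \<times> nat \<Rightarrow> nat list \<Rightarrow> nat list"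
  where "perm_b i = (\<lambda>(b1, b2, b3). cycle_of_list [[b1, i], [b2, i], [b3, i]])"

text \<open>For an admissible triple, \<open>x \<in> [4]\<close> differs from \<open>i\<close> iff it is one of the \<open>b\<^sub>k\<close>; the three
  cycles are disjoint, so their order is immaterial.\<close>

definition perm_c :: "nat \<times> nat \<times> nat \<Rightarrow> nat list \<Rightarrow> nat list"
  where "perm_c = (\<lambda>(b1, b2, b3).
    row_cycle b1 (b1, b2, b3) \<circ> row_cycle b2 (b1, b2, b3) \<circ> row_cycle b3 (b1, b2, b3))"

definition perm_t :: "nat \<times> nat \<times> nat \<Rightarrow> nat list \<Rightarrow> nat list"
  where "perm_t = (\<lambda>(b1, b2, b3). cycle_of_list [[b1], [b3]])"

definition L_group :: "'a cstar \<Rightarrow> (nat \<Rightarrow> 'a) \<Rightarrow> nat \<Rightarrow> nat \<times> nat \<times> nat \<Rightarrow> ('a \<Rightarrow> 'a) set"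
  where "L_group A S i b = generate (cstar_Aut A)
    {perm_endo 4 A S 2 (perm_a i b), perm_endo 4 A S 2 (perm_b i b),
     perm_endo 4 A S 2 (perm_c b), perm_endo 4 A S 2 (perm_tensor 4 1 1 (perm_t b) id)}"


section \<open>Semidirect products\<close>

definition semidirect ::
  "('a, 'c) monoid_scheme \<Rightarrow> ('b, 'd) monoid_scheme \<Rightarrow> ('b \<Rightarrow> 'a \<Rightarrow> 'a) \<Rightarrow> ('a \<times> 'b) monoid"
  where "semidirect N H \<theta> =
    \<lparr>carrier = carrier N \<times> carrier H,
     monoid.mult = (\<lambda>(x, h) (y, k). (x \<otimes>\<^bsub>N\<^esub> \<theta> h y, h \<otimes>\<^bsub>H\<^esub> k)),
     one = (\<one>\<^bsub>N\<^esub>, \<one>\<^bsub>H\<^esub>)\<rparr>"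

abbreviation Z3_cubed :: "(int \<times> int \<times> int) monoid"
  where "Z3_cubed \<equiv> integer_mod_group 3 \<times>\<times> integer_mod_group 3 \<times>\<times> integer_mod_group 3"

end

theory Submission
  imports Defs
begin

text \<open>
  The elements of \<open>L\<^sub>i\<close> are the \<open>\<lambda>\<^sub>u\<close> for 54 explicit permutations \<open>u\<close> of \<open>[4]\<^sup>2\<close> that preserve the
  row \<open>{i} \<times> [4]\<close> and the column \<open>[4] \<times> {i}\<close>; composing them is a computation with words of length
  three, and gives \<open>\<int>\<^sub>3\<^sup>3\<close> with the generator of \<open>\<int>\<^sub>2\<close> acting by inversion.

  The analytic part is a rigidity statement. Let \<open>v\<close> be a unitary with \<open>v S\<^sub>x = \<lambda>\<^sub>u(S\<^sub>x) v\<close> for \<open>x = i\<close> and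
  for two further \<open>x\<close>, where \<open>\<lambda>\<^sub>u(S\<^sub>i) = S\<^sub>i V\<close> and \<open>V S\<^sub>i = S\<^sub>i\<close>. Compressing \<open>v\<close> by high powers of \<open>S\<^sub>i\<close>
  gives \<open>V v\<close>, while the same compression takes a polynomial in the generators close to \<open>v\<close> into the
  span of \<open>1\<close> and the powers of \<open>S\<^sub>i\<close> and \<open>S\<^sub>i\<^sup>*\<close>. Only the constant term survives in
  \<open>v = \<lambda>\<^sub>u(S\<^sub>x)\<^sup>* v S\<^sub>x\<close>, so \<open>v\<close> is almost a multiple of an explicit monomial combination, and this is
  compatible with invertibility only for \<open>u = 1\<close>. Inner automorphisms give such a \<open>v\<close>; so does an
  equality of \<open>\<lambda>\<^sub>a \<in> L\<^sub>i\<close> with an element of \<open>L\<^sub>j\<close> modulo inner automorphisms, because \<open>\<lambda>\<^sub>a\<close> fixes all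
  \<open>S\<^sub>x\<close> with \<open>x \<noteq> i\<close>.

  Density of the polynomials follows from the universal property, applied to their closure. The relations
  \<open>S\<^sub>i\<^sup>* S\<^sub>k = 0\<close> need \<open>h\<^sub>k = 0\<close> for \<open>h\<^sub>k = S\<^sub>i\<^sup>* S\<^sub>k S\<^sub>k\<^sup>* S\<^sub>i\<close>, whose sum over \<open>k \<noteq> i\<close> vanishes; instead of
  positivity of \<open>x\<^sup>* x\<close>, the proof uses that a self-adjoint \<open>g\<close> with \<open>1 + g\<close> and \<open>1 - g\<close>
  contractive must be \<open>0\<close>.
\<close>

section \<open>C*-algebras\<close>

context cstar_algebra
begin

text \<open>The locale \<^locale>\<open>module\<close> also provides the ring lemmas for the scalars, under the same names;
  here the names are made to refer to \<open>A\<close>.\<close>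

lemma ring_A: "ring A" and abelian_monoid_A: "abelian_monoid A" and semiring_A: "semiring A"
  and abelian_group_A: "abelian_group A"
  by unfold_locales

lemmas a_assoc = abelian_monoid.a_assoc[OF abelian_monoid_A]
  and a_comm = abelian_monoid.a_comm[OF abelian_monoid_A]
  and a_ac = abelian_monoid.a_ac[OF abelian_monoid_A]
  and m_assoc = monoid.m_assoc[OF semiring.axioms(2)[OF semiring_A]]
  and l_distr = semiring.l_distr[OF semiring_A]
  and r_distr = semiring.r_distr[OF semiring_A]
  and l_neg = abelian_group.l_neg[OF abelian_group_A]
  and r_neg = abelian_group.r_neg[OF abelian_group_A]
  and r_neg1 = abelian_group.r_neg1[OF abelian_group_A]
  and r_neg2 = abelian_group.r_neg2[OF abelian_group_A]
  and finsum_ldistr = semiring.finsum_ldistr[OF semiring_A]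
  and finsum_rdistr = semiring.finsum_rdistr[OF semiring_A]
  and finsum_cong' = abelian_monoid.finsum_cong'[OF abelian_monoid_A]
  and finsum_closed = abelian_monoid.finsum_closed[OF abelian_monoid_A]
  and finsum_singleton = abelian_monoid.finsum_singleton[OF abelian_monoid_A]
  and finsum_insert = abelian_monoid.finsum_insert[OF abelian_monoid_A]

section \<open>Scalars, adjoints and norm estimates\<close>

lemma smult_in_carrier [simp, intro]: "x \<in> carrier A \<Longrightarrow> c \<odot> x \<in> carrier A"
  using smult_closed[of c x] by (simp add: complex_field_def)

lemma smult_add_left: "x \<in> carrier A \<Longrightarrow> (c + d) \<odot> x = c \<odot> x \<oplus> d \<odot> x"
  using smult_l_distr[of c d x] by (simp add: complex_field_def)

lemma smult_add_right:
  "\<lbrakk>x \<in> carrier A; y \<in> carrier A\<rbrakk> \<Longrightarrow> c \<odot> (x \<oplus> y) = c \<odot> x \<oplus> c \<odot> y"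
  using smult_r_distr[of c x y] by (simp add: complex_field_def)

lemma smult_smult: "x \<in> carrier A \<Longrightarrow> c \<odot> (d \<odot> x) = (c * d) \<odot> x"
  using smult_assoc1[of c d x] by (simp add: complex_field_def)

lemma smult_1 [simp]: "x \<in> carrier A \<Longrightarrow> 1 \<odot> x = x"
  using smult_one[of x] by (simp add: complex_field_def)

lemma smult_0 [simp]: "x \<in> carrier A \<Longrightarrow> 0 \<odot> x = \<zero>"
  using smult_l_null[of x] by (simp add: complex_field_def)

lemma smult_zero [simp]: "c \<odot> \<zero> = \<zero>"
  using smult_r_null[of c] by (simp add: complex_field_def)

lemma smult_m1: "x \<in> carrier A \<Longrightarrow> (-1) \<odot> x = \<ominus> x"
  using smult_add_left[of x "-1" 1] by (metis l_neg abelian_group.minus_equality[OF abelian_group_A] add_neg_numeral_special(8) smult_0 smult_1 smult_in_carrier)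

lemma minus_eq_smult: "\<lbrakk>x \<in> carrier A; y \<in> carrier A\<rbrakk> \<Longrightarrow> x \<ominus> y = x \<oplus> (-1) \<odot> y"
  by (simp add: smult_m1 a_minus_def)

declare star_closed [simp, intro]

lemma star_zero [simp]: "star A \<zero> = \<zero>"
  using star_smult[of \<zero> 0] by simp

lemma star_one [simp]: "star A \<one> = \<one>"
proof -
  have "star A \<one> = star A (star A \<one>) \<otimes> star A \<one>"
    by (simp add: star_star)
  also have "\<dots> = star A (\<one> \<otimes> star A \<one>)"
    by (subst star_mult) auto
  finally show ?thesis by (simp add: star_star)
qed

lemma star_minus:
  "\<lbrakk>x \<in> carrier A; y \<in> carrier A\<rbrakk> \<Longrightarrow> star A (x \<ominus> y) = star A x \<ominus> star A y"
  by (simp add: minus_eq_smult star_add star_smult)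

lemma star_finsum:
  "\<lbrakk>finite I; f \<in> I \<rightarrow> carrier A\<rbrakk> \<Longrightarrow> star A (\<Oplus>i\<in>I. f i) = (\<Oplus>i\<in>I. star A (f i))"
proof (induction I rule: finite_induct)
  case (insert i I)
  then show ?case by (simp add: star_add Pi_def)
qed simp

lemma nrm_zero [simp]: "nrm A \<zero> = 0"
  by (simp add: nrm_eq_zero)

lemma nrm_minus_commute:
  "\<lbrakk>x \<in> carrier A; y \<in> carrier A\<rbrakk> \<Longrightarrow> nrm A (x \<ominus> y) = nrm A (y \<ominus> x)"
  using nrm_smult[of "y \<ominus> x" "-1"] by (simp add: minus_eq_smult smult_add_right smult_smult a_comm)

lemma nrm_triangle_minus:
  assumes "x \<in> carrier A" "y \<in> carrier A" "z \<in> carrier A"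
  shows "nrm A (x \<ominus> z) \<le> nrm A (x \<ominus> y) + nrm A (y \<ominus> z)"
proof -
  have "x \<ominus> z = (x \<ominus> y) \<oplus> (y \<ominus> z)"
    using assms by (simp add: a_minus_def a_assoc l_neg r_neg1)
  then show ?thesis using assms nrm_triangle by simp
qed

lemma nrm_one [simp]: "nrm A \<one> = 1"
proof -
  have "nrm A \<one> \<noteq> 0" using one_not_zero by (simp add: nrm_eq_zero)
  moreover have "nrm A \<one> = (nrm A \<one>)\<^sup>2" using cstar_identity[of \<one>] by simp
  ultimately show ?thesis by (simp add: power2_eq_square)
qed

text \<open>The C*-identity and submultiplicativity bound the square of the norm of y by the product
  of the norms of y and of its adjoint. Cancelling one factor, for x and for its adjoint, gives both
  inequalities.\<close>

lemma nrm_star [simp]: "x \<in> carrier A \<Longrightarrow> nrm A (star A x) = nrm A x"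
proof -
  have le: "nrm A y \<le> nrm A (star A y)" if y: "y \<in> carrier A" for y
  proof (cases "nrm A y = 0")
    case False
    then have "nrm A y > 0" using nrm_nonneg[OF y] by simp
    moreover have "nrm A y * nrm A y \<le> nrm A (star A y) * nrm A y"
      using cstar_identity[OF y] nrm_mult[of "star A y" y] y by (simp add: power2_eq_square)
    ultimately show ?thesis by simp
  qed (use y nrm_nonneg in simp)
  show "nrm A (star A x) = nrm A x" if "x \<in> carrier A"
    using le[of x] le[of "star A x"] that by (simp add: star_star)
qed

lemma nrm_isometry:
  assumes "s \<in> carrier A" "star A s \<otimes> s = \<one>"
  shows "nrm A s = 1"
  using cstar_identity[OF assms(1)] assms(2) nrm_nonneg[OF assms(1)] by (simp add: power2_eq_1_iff)

lemma nrm_finsum_le: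
  fixes B :: real
  assumes "finite I" "\<And>i. i \<in> I \<Longrightarrow> f i \<in> carrier A" "\<And>i. i \<in> I \<Longrightarrow> nrm A (f i) \<le> B"
  shows "nrm A (\<Oplus>i\<in>I. f i) \<le> card I * B"
  using assms
proof (induction I rule: finite_induct)
  case (insert i I)
  have "nrm A (\<Oplus>i\<in>insert i I. f i) \<le> nrm A (f i) + nrm A (\<Oplus>i\<in>I. f i)"
    using insert by (simp add: Pi_def nrm_triangle)
  also have "\<dots> \<le> B + card I * B"
    using insert by (intro add_mono) auto
  finally show ?case using insert by (simp add: algebra_simps)
qed simp

lemma nrm_mult_le_1:
  assumes "x \<in> carrier A" "y \<in> carrier A" "nrm A x \<le> 1" "nrm A y \<le> 1"
  shows "nrm A (x \<otimes> y) \<le> 1"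
  using nrm_mult[OF assms(1,2)] mult_mono[OF assms(3,4)] nrm_nonneg assms(1,2) by force

lemma nrm_contract_left:
  assumes "x \<in> carrier A" "y \<in> carrier A" "nrm A x \<le> 1"
  shows "nrm A (x \<otimes> y) \<le> nrm A y"
  using nrm_mult[OF assms(1,2)] mult_right_mono[OF assms(3) nrm_nonneg[OF assms(2)]] by simp

lemma nrm_contract_right:
  assumes "x \<in> carrier A" "y \<in> carrier A" "nrm A y \<le> 1"
  shows "nrm A (x \<otimes> y) \<le> nrm A x"
  using nrm_mult[OF assms(1,2)] mult_left_mono[OF assms(3) nrm_nonneg[OF assms(1)]] by simp

lemma eq_if_close:
  assumes "x \<in> carrier A" "y \<in> carrier A" "\<And>e. e > 0 \<Longrightarrow> nrm A (x \<ominus> y) \<le> e"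
  shows "x = y"
proof -
  have "nrm A (x \<ominus> y) \<le> 0" using assms(3) by (rule field_le_epsilon) simp
  then have "x \<ominus> y = \<zero>" using nrm_nonneg[of "x \<ominus> y"] assms nrm_eq_zero[of "x \<ominus> y"] by simp
  then show ?thesis using assms by simp
qed

section \<open>Self-adjoint g with both 1 + g and 1 - g contractive\<close>

text \<open>Polynomials in g are handled through their four coefficients, so that an identity
  between combinations of them splits into four scalar equations.\<close>

definition cubic :: "'a \<Rightarrow> complex \<Rightarrow> complex \<Rightarrow> complex \<Rightarrow> complex \<Rightarrow> 'a"
  where "cubic g a b c d = a \<odot> \<one> \<oplus> b \<odot> g \<oplus> c \<odot> (g \<otimes> g) \<oplus> d \<odot> (g \<otimes> g \<otimes> g)"

lemma cubic_closed [simp]: "g \<in> carrier A \<Longrightarrow> cubic g a b c d \<in> carrier A"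
  by (simp add: cubic_def)

lemma cubic_add:
  "g \<in> carrier A \<Longrightarrow>
    cubic g a b c d \<oplus> cubic g a' b' c' d' = cubic g (a + a') (b + b') (c + c') (d + d')"
  by (simp add: cubic_def smult_add_left a_ac)

lemma cubic_smult:
  "g \<in> carrier A \<Longrightarrow> z \<odot> cubic g a b c d = cubic g (z * a) (z * b) (z * c) (z * d)"
  by (simp add: cubic_def smult_add_right smult_smult)

lemma cube_eq_cubic:
  assumes "g \<in> carrier A"
  shows "(\<one> \<oplus> z \<odot> g) \<otimes> (\<one> \<oplus> z \<odot> g) \<otimes> (\<one> \<oplus> z \<odot> g) = cubic g 1 (3 * z) (3 * z\<^sup>2) (z ^ 3)"
proof -
  have 3: "(3 * c) \<odot> x = c \<odot> x \<oplus> (c \<odot> x \<oplus> c \<odot> x)" if "x \<in> carrier A" for c x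
    using smult_add_left[OF that, of c "2 * c"] smult_add_left[OF that, of c c]
    by (simp add: mult_2 algebra_simps)
  show ?thesis using assms
    by (simp add: cubic_def 3 l_distr r_distr smult_add_right smult_smult smult_mult_left
        smult_mult_right m_assoc a_ac power2_eq_square power3_eq_cube mult.assoc)
qed

text \<open>The five nodes \<open>z\<close> and weights below are chosen so that the means of \<open>z\<close>, \<open>z\<^sup>2\<close>, \<open>z\<^sup>3\<close>
  are \<open>1/2\<close>, \<open>0\<close>, \<open>0\<close>; then the mean of \<open>(1 + z g)\<^sup>3\<close> is \<open>1 + (3/2) g\<close>. The nodes lie in the
  square spanned by \<open>1\<close>, \<open>-1\<close>, \<open>\<i>\<close>, \<open>-\<i>\<close>, where \<open>1 + z g\<close> is contractive.\<close>

lemma selfadjoint_dilate: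
  assumes g: "g \<in> carrier A" "star A g = g"
    and p: "nrm A (\<one> \<oplus> g) \<le> 1" and m: "nrm A (\<one> \<oplus> (-1) \<odot> g) \<le> 1"
  shows "nrm A (\<one> \<oplus> (3/2) \<odot> g) \<le> 1"
proof -
  let ?N = "\<lambda>z. nrm A (\<one> \<oplus> z \<odot> g)"
  have N1: "?N 1 \<le> 1" using p g by simp
  have comb: "nrm A (c \<odot> x \<oplus> d \<odot> y) \<le> 1"
    if "x \<in> carrier A" "y \<in> carrier A" "nrm A x \<le> 1" "nrm A y \<le> 1" "cmod c + cmod d \<le> 1" for c d x y
  proof -
    have "nrm A (c \<odot> x \<oplus> d \<odot> y) \<le> cmod c * nrm A x + cmod d * nrm A y"
      using nrm_triangle[of "c \<odot> x" "d \<odot> y"] that by (simp add: nrm_smult)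
    also have "\<dots> \<le> cmod c * 1 + cmod d * 1"
      using that by (intro add_mono mult_left_mono) auto
    finally show ?thesis using that by simp
  qed
  \<comment> \<open>1 + g^2 is the mean of the squares of 1 + g and 1 - g.\<close>
  have sq: "nrm A (\<one> \<oplus> g \<otimes> g) \<le> 1"
  proof -
    have "\<one> \<oplus> g \<otimes> g = (1/2) \<odot> ((\<one> \<oplus> 1 \<odot> g) \<otimes> (\<one> \<oplus> 1 \<odot> g))
        \<oplus> (1/2) \<odot> ((\<one> \<oplus> (-1) \<odot> g) \<otimes> (\<one> \<oplus> (-1) \<odot> g))"
    proof -
      have *: "(1/2) \<odot> ((\<one> \<oplus> z \<odot> g) \<otimes> (\<one> \<oplus> z \<odot> g)) = cubic g (1/2) z (z\<^sup>2/2) 0" for z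
        using g by (simp add: cubic_def l_distr r_distr smult_add_right smult_smult smult_mult_left
            smult_mult_right m_assoc a_ac power2_eq_square flip: smult_add_left)
          (simp add: a_assoc[symmetric] flip: smult_add_left)
      show ?thesis unfolding * cubic_add[OF g(1)] using g by (simp add: cubic_def)
    qed
    then show ?thesis using g p m
      by (auto intro!: comb nrm_mult_le_1)
  qed
  \<comment> \<open>For imaginary z the adjoint of 1 + z g is 1 - z g, so the C*-identity reduces
    the norm to that of 1 + g^2.\<close>
  have imag: "?N z \<le> 1" if "z = \<i> \<or> z = -\<i>" for z
  proof -
    have "(?N z)\<^sup>2 = nrm A ((\<one> \<oplus> (-z) \<odot> g) \<otimes> (\<one> \<oplus> z \<odot> g))"
      using that g cstar_identity[of "\<one> \<oplus> z \<odot> g"] by (auto simp add: star_add star_smult)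
    also have "(\<one> \<oplus> (-z) \<odot> g) \<otimes> (\<one> \<oplus> z \<odot> g) = \<one> \<oplus> g \<otimes> g"
    proof -
      have "(\<one> \<oplus> (-z) \<odot> g) \<otimes> (\<one> \<oplus> z \<odot> g) = \<one> \<oplus> (z \<odot> g \<oplus> ((-z) \<odot> g \<oplus> (-z*z) \<odot> (g \<otimes> g)))"
        using g by (simp add: l_distr r_distr smult_add_right smult_smult smult_mult_left
            smult_mult_right a_ac)
      also have "(-z*z) \<odot> (g \<otimes> g) = g \<otimes> g" using that g by auto
      also have "z \<odot> g \<oplus> ((-z) \<odot> g \<oplus> g \<otimes> g) = g \<otimes> g"
        using g smult_add_left[of g z "-z"] by (simp flip: a_assoc)
      finally show ?thesis .
    qed
    finally show ?thesis using sq abs_square_le_1[of "?N z"] by simp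
  qed
  \<comment> \<open>These two nodes are midpoints of 1 and z, and contractivity passes to convex
    combinations.\<close>
  have diag: "?N ((1 + z) / 2) \<le> 1" if "z = \<i> \<or> z = -\<i>" for z
  proof -
    have "\<one> \<oplus> ((1 + z) / 2) \<odot> g = (1/2) \<odot> (\<one> \<oplus> 1 \<odot> g) \<oplus> (1/2) \<odot> (\<one> \<oplus> z \<odot> g)"
    proof -
      have *: "(1/2) \<odot> (\<one> \<oplus> z \<odot> g) = cubic g (1/2) (z/2) 0 0" for z
        using g by (simp add: cubic_def smult_add_right smult_smult)
      show ?thesis unfolding * cubic_add[OF g(1)]
        using g by (simp add: cubic_def add_divide_distrib)
    qed
    then show ?thesis using g N1 imag[OF that] by (auto intro!: comb)
  qed
  define C where "C z = (\<one> \<oplus> z \<odot> g) \<otimes> (\<one> \<oplus> z \<odot> g) \<otimes> (\<one> \<oplus> z \<odot> g)" for z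
  have C: "C z \<in> carrier A" for z using g by (simp add: C_def)
  have CN: "nrm A (C z) \<le> 1" if "?N z \<le> 1" for z
    unfolding C_def using that g by (intro nrm_mult_le_1) auto
  have "\<one> \<oplus> (3/2) \<odot> g = (1/6) \<odot> C 1 \<oplus> (1/12) \<odot> C \<i> \<oplus> (1/12) \<odot> C (-\<i>)
      \<oplus> (1/3) \<odot> C ((1 + \<i>) / 2) \<oplus> (1/3) \<odot> C ((1 + -\<i>) / 2)"
  proof -
    have eq: "cubic g a b c d = cubic g a' b' c' d'" if "a = a'" "b = b'" "c = c'" "d = d'"
      for a b c d a' b' c' d' using that by simp
    have "\<one> \<oplus> (3/2) \<odot> g = cubic g 1 (3/2) 0 0" using g by (simp add: cubic_def)
    then show ?thesis
      unfolding C_def cube_eq_cubic[OF g(1)] cubic_smult[OF g(1)] cubic_add[OF g(1)]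
      by (elim trans, intro eq)
        (simp_all add: complex_eq_iff power2_eq_square power3_eq_cube)
  qed
  moreover have "nrm A \<dots> \<le> 1/6 + 1/12 + 1/12 + 1/3 + 1/3"
  proof -
    have w: "nrm A (c \<odot> C z) \<le> cmod c" if "?N z \<le> 1" for c z
      using CN[OF that] nrm_smult[OF C, of c z] mult_left_mono[OF CN[OF that], of "cmod c"]
      by simp
    have tri: "nrm A (x \<oplus> y) \<le> a + b"
      if "x \<in> carrier A" "y \<in> carrier A" "nrm A x \<le> a" "nrm A y \<le> b" for x y a b
      using nrm_triangle[of x y] that by simp
    have *: "nrm A ((1/6) \<odot> C 1) \<le> 1/6" "nrm A ((1/12) \<odot> C \<i>) \<le> 1/12"
      "nrm A ((1/12) \<odot> C (-\<i>)) \<le> 1/12" "nrm A ((1/3) \<odot> C ((1 + \<i>) / 2)) \<le> 1/3"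
      "nrm A ((1/3) \<odot> C ((1 + -\<i>) / 2)) \<le> 1/3"
      using w[of 1 "1/6"] w[of \<i> "1/12"] w[of "-\<i>" "1/12"] w[of "(1 + \<i>) / 2" "1/3"]
        w[of "(1 + -\<i>) / 2" "1/3"] N1 imag diag[of \<i>] diag[of "-\<i>"]
      by (simp_all add: norm_divide)
    show ?thesis
      by (intro tri *) (simp_all add: C)
  qed
  ultimately show ?thesis by simp
qed

text \<open>Dilation by 3/2 can be iterated on g and -g, so 1 + (3/2)^k g stays contractive for
  every k. Then (3/2)^k times the norm of g never exceeds 2, which forces g = 0.\<close>

lemma selfadjoint_zero:
  assumes g: "g \<in> carrier A" "star A g = g"
    and p: "nrm A (\<one> \<oplus> g) \<le> 1" and m: "nrm A (\<one> \<oplus> (-1) \<odot> g) \<le> 1"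
  shows "g = \<zero>"
proof -
  have *: "nrm A (\<one> \<oplus> ((3/2)^k) \<odot> g) \<le> 1 \<and> nrm A (\<one> \<oplus> (-((3/2)^k)) \<odot> g) \<le> 1" for k :: nat
  proof (induction k)
    case (Suc k)
    let ?h = "((3/2)^k) \<odot> g"
    have st: "star A ?h = ?h" "star A ((-1) \<odot> ?h) = (-1) \<odot> ?h" using g by (simp_all add: star_smult)
    have "nrm A (\<one> \<oplus> (3/2) \<odot> ?h) \<le> 1"
      using g Suc st by (intro selfadjoint_dilate) (auto simp: smult_smult)
    moreover have "nrm A (\<one> \<oplus> (3/2) \<odot> ((-1) \<odot> ?h)) \<le> 1"
      using g Suc st by (intro selfadjoint_dilate) (auto simp: smult_smult)
    ultimately show ?case using g by (simp add: smult_smult)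
  qed (use p m g in simp)
  have "(3/2)^k * nrm A g \<le> 2" for k :: nat
  proof -
    have "((3/2)^k) \<odot> g = (\<one> \<oplus> ((3/2)^k) \<odot> g) \<ominus> \<one>"
      using g by (simp add: a_minus_def a_ac r_neg2)
    then have "nrm A (((3/2)^k) \<odot> g) \<le> nrm A (\<one> \<oplus> ((3/2)^k) \<odot> g) + nrm A ((-1) \<odot> \<one>)"
      using g nrm_triangle[of "\<one> \<oplus> ((3/2)^k) \<odot> g" "(-1) \<odot> \<one>"] by (simp add: minus_eq_smult)
    then show ?thesis using *[of k] g by (simp add: nrm_smult norm_power norm_divide)
  qed
  moreover have "\<exists>k. 2 / nrm A g < (3/2)^k" by (rule real_arch_pow) simp
  ultimately have "\<not> nrm A g > 0"
    by (auto simp: field_simps not_le) (meson not_le)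
  then show ?thesis using g nrm_nonneg nrm_eq_zero by force
qed

end

section \<open>Orthogonality of the ranges of a Cuntz family\<close>

context cstar_algebra
begin

lemma add_smult_m1: "x \<in> carrier A \<Longrightarrow> x \<oplus> (-1) \<odot> x = \<zero>"
  by (simp add: smult_m1 r_neg)

lemma nrm_projection:
  assumes p: "p \<in> carrier A" "star A p = p" "p \<otimes> p = p"
  shows "nrm A p \<le> 1"
proof -
  have "(nrm A p)\<^sup>2 = nrm A p" using cstar_identity[OF p(1)] p by simp
  then show ?thesis by (auto simp: power2_eq_square)
qed

lemma identity_star_hom: "(\<lambda>x\<in>carrier A. x) \<in> star_hom A A"
  by (simp add: star_hom_def ring_hom_def)

lemma cuntz_family_closed [simp]:
  "\<lbrakk>cuntz_family n A S; i \<in> {1..n}\<rbrakk> \<Longrightarrow> S i \<in> carrier A"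
  by (simp add: cuntz_family_def)

lemma cuntz_family_isometry:
  "\<lbrakk>cuntz_family n A S; i \<in> {1..n}\<rbrakk> \<Longrightarrow> star A (S i) \<otimes> S i = \<one>"
  by (simp add: cuntz_family_def)

text \<open>1 - t t^* is a projection, hence contractive, and compressing it by an isometry keeps
  the norm at most one.\<close>

lemma compressed_complement_le:
  assumes s: "s \<in> carrier A" "star A s \<otimes> s = \<one>" and t: "t \<in> carrier A" "star A t \<otimes> t = \<one>"
  shows "nrm A (\<one> \<ominus> star A s \<otimes> t \<otimes> star A t \<otimes> s) \<le> 1"
proof -
  let ?p = "\<one> \<ominus> t \<otimes> star A t"
  have tt: "t \<otimes> star A t \<otimes> (t \<otimes> star A t) = t \<otimes> star A t"
  proof -
    have "t \<otimes> star A t \<otimes> (t \<otimes> star A t) = t \<otimes> (star A t \<otimes> t) \<otimes> star A t"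
      using t(1) by (simp add: m_assoc)
    then show ?thesis using t by simp
  qed
  have "?p \<otimes> ?p = ?p"
    using t tt by (simp add: minus_eq_smult l_distr r_distr smult_mult_left smult_mult_right smult_smult)
      (simp add: a_assoc smult_add_right smult_smult add_smult_m1)
  then have "nrm A ?p \<le> 1"
    using t by (intro nrm_projection) (simp_all add: star_minus star_mult star_star)
  then have "nrm A (star A s \<otimes> ?p \<otimes> s) \<le> 1"
    using s t nrm_isometry[OF s] by (intro nrm_mult_le_1) auto
  also have "star A s \<otimes> ?p \<otimes> s = \<one> \<ominus> star A s \<otimes> t \<otimes> star A t \<otimes> s"
    using s t by (simp add: minus_eq_smult l_distr r_distr smult_mult_left smult_mult_right m_assoc)
  finally show ?thesis .
qed

text \<open>Put h_l = S_i^* S_l S_l^* S_i. The h_l sum to 1 and h_i = 1, so the others sum to 0.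
  With N indices besides i and k, N + h_k is therefore the sum of the N contractions 1 - h_l, and 1
  - h_k is a contraction too. After scaling, h_k meets the hypotheses of
  \<open>selfadjoint_zero\<close>.\<close>

lemma cuntz_family_orthogonal:
  assumes fam: "cuntz_family n A S" and i: "i \<in> {1..n}" and k: "k \<in> {1..n}" and ik: "i \<noteq> k"
  shows "star A (S i) \<otimes> S k = \<zero>"
proof -
  note S = cuntz_family_closed[OF fam] and iso = cuntz_family_isometry[OF fam]
  define h where "h l = star A (S i) \<otimes> S l \<otimes> star A (S l) \<otimes> S i" for l
  have h: "h l \<in> carrier A" if "l \<in> {1..n}" for l using that S i by (simp add: h_def)
  have "(\<Oplus>l\<in>{1..n}. h l) = star A (S i) \<otimes> (\<Oplus>l\<in>{1..n}. S l \<otimes> star A (S l)) \<otimes> S i"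
  proof -
    have "(\<Oplus>l\<in>{1..n}. h l) = (\<Oplus>l\<in>{1..n}. star A (S i) \<otimes> (S l \<otimes> star A (S l)) \<otimes> S i)"
      using S i by (intro finsum_cong') (auto simp: h_def m_assoc)
    then show ?thesis
      using S i by (simp add: finsum_ldistr finsum_rdistr Pi_def)
  qed
  also have "\<dots> = \<one>" using fam i S iso by (simp add: cuntz_family_def)
  finally have sum1: "(\<Oplus>l\<in>{1..n}. h l) = \<one>" .
  have hi: "h i = \<one>" using iso[OF i] S[OF i] by (simp add: h_def m_assoc)
  define R where "R = {1..n} - {i, k}"
  have R: "{1..n} = insert i (insert k R)" "finite R" "R \<subseteq> {1..n}" "i \<notin> R" "k \<notin> R"
    using i k by (auto simp: R_def)
  have hR: "h l \<in> carrier A" if "l \<in> R" for l using h R(3) that by blast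
  define r where "r = (\<Oplus>l\<in>R. h l)"
  have r: "r \<in> carrier A" using hR by (auto simp: r_def intro!: finsum_closed)
  have "(\<Oplus>l\<in>insert i (insert k R). h l) = h i \<oplus> (h k \<oplus> r)"
    using h[OF i] h[OF k] hR ik R(2,4,5) unfolding r_def by (simp add: finsum_insert Pi_iff)
  then have "\<one> \<oplus> (h k \<oplus> r) = \<one>" using sum1 R(1) hi by simp
  then have "h k \<oplus> r = \<zero>" using h[OF k] r r_neg2[of \<one> "h k \<oplus> r"]
    by (simp add: l_neg)
  then have rk: "(-1) \<odot> r = h k" using h[OF k] r
    using abelian_group.minus_equality[OF abelian_group_A, of "h k" r] by (simp add: smult_m1)
  have rsum: "(\<Oplus>l\<in>I. \<one> \<ominus> h l) = of_nat (card I) \<odot> \<one> \<oplus> (-1) \<odot> (\<Oplus>l\<in>I. h l)"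
    if "finite I" "I \<subseteq> {1..n}" for I
    using that
  proof (induction I rule: finite_induct)
    case (insert l I)
    have "(\<Oplus>l\<in>I. h l) \<in> carrier A" using insert h by (intro finsum_closed) auto
    then show ?case using insert h
      by (simp add: finsum_insert Pi_def subset_iff minus_eq_smult smult_add_left smult_add_right a_ac)
  qed simp
  define N where "N = card R"
  have Nle: "nrm A (of_nat N \<odot> \<one> \<oplus> h k) \<le> N"
  proof -
    have "nrm A (\<Oplus>l\<in>R. \<one> \<ominus> h l) \<le> real (card R) * 1"
    proof (intro nrm_finsum_le R(2))
      fix l assume l: "l \<in> R"
      then have "l \<in> {1..n}" using R(3) by blast
      then show "nrm A (\<one> \<ominus> h l) \<le> 1"
        unfolding h_def using S iso i by (intro compressed_complement_le) auto
    qed (use hR in auto)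
    then show ?thesis using rsum[of R] R by (simp add: N_def rk flip: r_def)
  qed
  \<comment> \<open>The scale N + 1 fits both signs: 1 + g is the mean of 1 and the N contractions 1
    - h_l with l in \<open>R\<close>, while 1 - g is the mean of N copies of 1 and of 1 -
    h_k.\<close>
  define M :: complex where "M = of_nat (Suc N)"
  have M: "M \<noteq> 0" "cmod M = Suc N" "M = of_nat N + 1"
    using norm_of_nat[of "Suc N", where 'a = complex] of_nat_eq_0_iff[of "Suc N", where 'a = complex]
    by (simp_all add: M_def del: norm_of_nat of_nat_eq_0_iff)
  define g where "g = (1 / M) \<odot> h k"
  have g: "g \<in> carrier A" using h k by (simp add: g_def)
  have sa: "star A g = g"
    using S i k by (simp add: g_def h_def star_smult star_mult star_star m_assoc M_def)
  have one: "(1 / M) \<odot> \<one> \<oplus> (of_nat N / M) \<odot> \<one> = \<one>"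
    using M by (simp flip: smult_add_left add_divide_distrib) (simp add: add.commute)
  have p: "nrm A (\<one> \<oplus> g) \<le> 1"
  proof -
    have "\<one> \<oplus> g = (1 / M) \<odot> (\<one> \<oplus> (of_nat N \<odot> \<one> \<oplus> h k))"
      using h[OF k] one by (simp add: smult_add_right smult_smult g_def flip: a_assoc)
    also have "nrm A \<dots> = (1 / Suc N) * nrm A (\<one> \<oplus> (of_nat N \<odot> \<one> \<oplus> h k))"
      using h[OF k] M(2) by (simp add: nrm_smult norm_divide)
    also have "\<dots> \<le> (1 / Suc N) * (1 + N)"
      using Nle h[OF k] nrm_triangle[of \<one> "of_nat N \<odot> \<one> \<oplus> h k"] by (intro mult_left_mono) auto
    finally show ?thesis by simp
  qed
  have m: "nrm A (\<one> \<oplus> (-1) \<odot> g) \<le> 1"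
  proof -
    have "\<one> \<oplus> (-1) \<odot> g = (of_nat N / M) \<odot> \<one> \<oplus> (1 / M) \<odot> (\<one> \<ominus> h k)"
    proof -
      have "(of_nat N / M) \<odot> \<one> \<oplus> (1 / M) \<odot> \<one> = \<one>"
        using one by (simp add: a_comm)
      then show ?thesis using h[OF k]
        by (simp add: minus_eq_smult smult_add_right smult_smult g_def flip: a_assoc)
    qed
    also have "nrm A \<dots> \<le> N / Suc N + (1 / Suc N) * nrm A (\<one> \<ominus> h k)"
      using h[OF k] nrm_triangle[of "(of_nat N / M) \<odot> \<one>" "(1 / M) \<odot> (\<one> \<ominus> h k)"] M(2)
      by (simp add: nrm_smult norm_divide)
    also have "\<dots> \<le> N / Suc N + (1 / Suc N) * 1"
      using S iso i k unfolding h_def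
      by (intro add_left_mono mult_left_mono compressed_complement_le) auto
    also have "\<dots> = 1"
      by (simp flip: add_divide_distrib)
    finally show ?thesis .
  qed
  have "M \<odot> g = h k" using h[OF k] M by (simp add: g_def smult_smult)
  then have "h k = \<zero>" using selfadjoint_zero[OF g sa p m] by simp
  \<comment> \<open>h_k = y^* y for y = S_k^* S_i, so the C*-identity turns h_k = 0 into y =
    0.\<close>
  moreover have "h k = star A (star A (S k) \<otimes> S i) \<otimes> (star A (S k) \<otimes> S i)"
    using S i k by (simp add: h_def star_mult star_star m_assoc)
  ultimately have "nrm A (star A (S k) \<otimes> S i) = 0"
    using cstar_identity[of "star A (S k) \<otimes> S i"] S i k by simp
  then have "star A (S k) \<otimes> S i = \<zero>" using S i k by (simp add: nrm_eq_zero)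
  then have "star A (star A (S k) \<otimes> S i) = \<zero>" by simp
  then show ?thesis using S i k by (simp add: star_mult star_star)
qed

end

section \<open>Density of the polynomials in the generators\<close>

context cuntz_algebra
begin

abbreviation W :: "nat list \<Rightarrow> 'a"
  where "W \<equiv> word_isometry A S"

lemma S_closed [simp]: "i \<in> {1..n} \<Longrightarrow> S i \<in> carrier A"
  by (rule cuntz_family_closed[OF family])

lemma star_S_S: "\<lbrakk>i \<in> {1..n}; j \<in> {1..n}\<rbrakk> \<Longrightarrow> star A (S i) \<otimes> S j = (if i = j then \<one> else \<zero>)"
  using cuntz_family_orthogonal[OF family] cuntz_family_isometry[OF family] by simp

lemma W_Nil [simp]: "W [] = \<one>"
  and W_Cons: "W (i # \<alpha>) = S i \<otimes> W \<alpha>"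
  by (simp_all add: word_isometry_def)

lemma W_closed [simp]: "set \<alpha> \<subseteq> {1..n} \<Longrightarrow> W \<alpha> \<in> carrier A"
  by (induction \<alpha>) (auto simp: W_Cons)

lemma W_append: "\<lbrakk>set \<alpha> \<subseteq> {1..n}; set \<beta> \<subseteq> {1..n}\<rbrakk> \<Longrightarrow> W (\<alpha> @ \<beta>) = W \<alpha> \<otimes> W \<beta>"
  by (induction \<alpha>) (auto simp: W_Cons m_assoc)

lemma star_W_W:
  "\<lbrakk>length \<alpha> = length \<beta>; set \<alpha> \<subseteq> {1..n}; set \<beta> \<subseteq> {1..n}\<rbrakk> \<Longrightarrow>
    star A (W \<alpha>) \<otimes> W \<beta> = (if \<alpha> = \<beta> then \<one> else \<zero>)"
proof (induction \<alpha> \<beta> rule: list_induct2)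
  case (Cons i \<alpha> j \<beta>)
  have "star A (W (i # \<alpha>)) \<otimes> W (j # \<beta>) = star A (W \<alpha>) \<otimes> ((star A (S i) \<otimes> S j) \<otimes> W \<beta>)"
    using Cons.prems by (simp add: W_Cons star_mult m_assoc)
  then show ?case using Cons star_S_S[of i j] by (auto split: if_splits)
qed simp

section \<open>The star algebra spanned by the monomials\<close>

inductive_set monomial_span :: "'a set"
  where
    monomial: "\<lbrakk>set \<alpha> \<subseteq> {1..n}; set \<beta> \<subseteq> {1..n}\<rbrakk> \<Longrightarrow> W \<alpha> \<otimes> star A (W \<beta>) \<in> monomial_span"
  | add: "\<lbrakk>x \<in> monomial_span; y \<in> monomial_span\<rbrakk> \<Longrightarrow> x \<oplus> y \<in> monomial_span"
  | smult: "x \<in> monomial_span \<Longrightarrow> c \<odot> x \<in> monomial_span"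

lemma monomial_span_closed [simp]: "x \<in> monomial_span \<Longrightarrow> x \<in> carrier A"
  by (induction rule: monomial_span.induct) simp_all

lemma one_in_monomial_span: "\<one> \<in> monomial_span"
  using monomial_span.monomial[of "[]" "[]"] by simp

lemma zero_in_monomial_span: "\<zero> \<in> monomial_span"
  using monomial_span.smult[OF one_in_monomial_span, of 0] by simp

lemma S_in_monomial_span: "i \<in> {1..n} \<Longrightarrow> S i \<in> monomial_span"
  using monomial_span.monomial[of "[i]" "[]"] by (simp add: W_Cons)

lemma star_in_monomial_span: "x \<in> monomial_span \<Longrightarrow> star A x \<in> monomial_span"
proof (induction rule: monomial_span.induct)
  case (monomial \<alpha> \<beta>)
  then show ?case using monomial_span.monomial[of \<beta> \<alpha>] by (simp add: star_mult star_star)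
qed (simp_all add: star_add star_smult monomial_span.intros)

lemma S_mult_in_monomial_span:
  assumes "x \<in> monomial_span" "i \<in> {1..n}"
  shows "S i \<otimes> x \<in> monomial_span"
  using assms
proof (induction rule: monomial_span.induct)
  case (monomial \<alpha> \<beta>)
  then show ?case using monomial_span.monomial[of "i # \<alpha>" \<beta>] by (simp add: W_Cons m_assoc)
qed (simp_all add: r_distr smult_mult_right monomial_span.intros)

text \<open>If the left word is empty, the letter joins the end of the right word. Otherwise
  orthogonality either cancels the first letter of the left word or kills the monomial.\<close>

lemma star_S_mult_in_monomial_span:
  assumes "x \<in> monomial_span" "i \<in> {1..n}"
  shows "star A (S i) \<otimes> x \<in> monomial_span"
  using assms
proof (induction rule: monomial_span.induct)
  case (monomial \<alpha> \<beta>)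
  show ?case
  proof (cases \<alpha>)
    case Nil
    then show ?thesis using monomial monomial_span.monomial[of "[]" "\<beta> @ [i]"]
      by (simp add: W_append W_Cons star_mult)
  next
    case (Cons j \<gamma>)
    have "star A (S i) \<otimes> (W \<alpha> \<otimes> star A (W \<beta>)) = (star A (S i) \<otimes> S j) \<otimes> (W \<gamma> \<otimes> star A (W \<beta>))"
      using monomial Cons by (simp add: W_Cons m_assoc)
    then show ?thesis
      using monomial Cons star_S_S[of i j] monomial_span.monomial[of \<gamma> \<beta>] zero_in_monomial_span
      by auto
  qed
qed (simp_all add: r_distr smult_mult_right monomial_span.intros)

text \<open>The left factor acts one letter at a time, first through the adjoints of the letters of
  its right word and then through the letters of its left word, so the one-letter cases
  suffice.\<close>

lemma mult_in_monomial_span: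
  assumes "x \<in> monomial_span" "y \<in> monomial_span"
  shows "x \<otimes> y \<in> monomial_span"
  using assms(1)
proof (induction rule: monomial_span.induct)
  case (monomial \<alpha> \<beta>)
  have "star A (W \<beta>) \<otimes> z \<in> monomial_span" if "z \<in> monomial_span" for z
    using monomial(2) that
  proof (induction \<beta> arbitrary: z)
    case (Cons i \<beta>)
    then have "star A (W \<beta>) \<otimes> (star A (S i) \<otimes> z) \<in> monomial_span"
      using star_S_mult_in_monomial_span by simp
    then show ?case using Cons.prems by (simp add: W_Cons star_mult m_assoc)
  qed simp
  moreover have "W \<alpha> \<otimes> z \<in> monomial_span" if "z \<in> monomial_span" for z
    using monomial(1) that
  proof (induction \<alpha>)
    case (Cons i \<alpha>)
    then show ?case using S_mult_in_monomial_span[of "W \<alpha> \<otimes> z" i] by (simp add: W_Cons m_assoc)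
  qed simp
  ultimately show ?case using monomial assms(2) by (simp add: m_assoc)
qed (simp_all add: assms l_distr smult_mult_left monomial_span.intros)

section \<open>The norm closure of the span as a C*-algebra\<close>

definition monomial_closure :: "'a set"
  where "monomial_closure =
    {y \<in> carrier A. \<forall>e>0. \<exists>p\<in>monomial_span. nrm A (y \<ominus> p) < e}"

lemma monomial_closure_closed [simp]: "x \<in> monomial_closure \<Longrightarrow> x \<in> carrier A"
  by (simp add: monomial_closure_def)

lemma monomial_closureD:
  assumes "x \<in> monomial_closure" "e > 0"
  obtains p where "p \<in> monomial_span" "nrm A (x \<ominus> p) < e"
proof -
  have "\<exists>p\<in>monomial_span. nrm A (x \<ominus> p) < e"
    using assms unfolding monomial_closure_def by simp
  then show thesis using that by (elim bexE)
qed

lemma span_in_closure: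
  assumes "x \<in> monomial_span" shows "x \<in> monomial_closure"
proof -
  have "nrm A (x \<ominus> x) = 0" using assms by (simp add: a_minus_def r_neg)
  then show ?thesis using assms unfolding monomial_closure_def by force
qed

lemma closure_add:
  assumes x: "x \<in> monomial_closure" and y: "y \<in> monomial_closure"
  shows "x \<oplus> y \<in> monomial_closure"
  unfolding monomial_closure_def
proof (intro CollectI conjI allI impI)
  fix e :: real assume "e > 0"
  obtain p where p: "p \<in> monomial_span" "nrm A (x \<ominus> p) < e/2"
    by (rule monomial_closureD[OF x half_gt_zero[OF \<open>e > 0\<close>]])
  obtain q where q: "q \<in> monomial_span" "nrm A (y \<ominus> q) < e/2"
    by (rule monomial_closureD[OF y half_gt_zero[OF \<open>e > 0\<close>]])
  have "(x \<oplus> y) \<ominus> (p \<oplus> q) = (x \<ominus> p) \<oplus> (y \<ominus> q)"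
    using x y p q by (simp add: minus_eq_smult smult_add_right a_ac)
  then have "nrm A ((x \<oplus> y) \<ominus> (p \<oplus> q)) < e"
    using nrm_triangle[of "x \<ominus> p" "y \<ominus> q"] x y p q by simp
  then show "\<exists>r\<in>monomial_span. nrm A ((x \<oplus> y) \<ominus> r) < e"
    using p q monomial_span.add by blast
qed (use x y in simp)

lemma closure_mult:
  assumes x: "x \<in> monomial_closure" and y: "y \<in> monomial_closure"
  shows "x \<otimes> y \<in> monomial_closure"
  unfolding monomial_closure_def
proof (intro CollectI conjI allI impI)
  fix e :: real assume e: "e > 0"
  have ny: "nrm A y \<ge> 0" and nx: "nrm A x \<ge> 0" using x y nrm_nonneg by auto
  \<comment> \<open>The cap at 1 keeps the norm of the approximant p at most
    \<open>nrm A x + 1\<close>; adding 1 to \<open>nrm A y\<close> avoids a division by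
    zero.\<close>
  define d where "d = min 1 (e / (2 * (nrm A y + 1)))"
  have d: "d > 0" "d \<le> 1" "d * (nrm A y + 1) \<le> e/2"
  proof -
    have pos: "2 * (nrm A y + 1) > 0" using ny by simp
    then show "d > 0" "d \<le> 1" using e by (simp_all add: d_def)
    have "d * (2 * (nrm A y + 1)) \<le> e"
      unfolding pos_le_divide_eq[OF pos, symmetric] by (simp add: d_def)
    then show "d * (nrm A y + 1) \<le> e/2" by (simp add: algebra_simps)
  qed
  obtain p where p: "p \<in> monomial_span" "nrm A (x \<ominus> p) < d"
    by (rule monomial_closureD[OF x d(1)])
  define d' where "d' = e / (2 * (nrm A x + 1))"
  have d': "d' > 0" "(nrm A x + 1) * d' = e/2"
    using e nx add_nonneg_pos[of "nrm A x" 1] by (simp_all add: d'_def field_simps)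
  obtain q where q: "q \<in> monomial_span" "nrm A (y \<ominus> q) < d'"
    by (rule monomial_closureD[OF y d'(1)])
  have "nrm A (p \<ominus> \<zero>) \<le> nrm A (p \<ominus> x) + nrm A (x \<ominus> \<zero>)"
    using x p by (intro nrm_triangle_minus) auto
  then have np: "nrm A p \<le> nrm A x + 1"
    using p d x nrm_minus_commute[of x p] by (simp add: minus_eq_smult)
  have "(x \<otimes> y) \<ominus> (p \<otimes> q) = (x \<ominus> p) \<otimes> y \<oplus> p \<otimes> (y \<ominus> q)"
  proof -
    have "(x \<ominus> p) \<otimes> y \<oplus> p \<otimes> (y \<ominus> q)
        = x \<otimes> y \<oplus> ((-1) \<odot> (p \<otimes> y) \<oplus> p \<otimes> y) \<oplus> (-1) \<odot> (p \<otimes> q)"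
      using x y p q
      by (simp add: minus_eq_smult l_distr r_distr smult_mult_left smult_mult_right a_assoc)
    moreover have "(-1) \<odot> (p \<otimes> y) \<oplus> p \<otimes> y = \<zero>"
      using p y add_smult_m1[of "p \<otimes> y"] by (simp add: a_comm)
    ultimately show ?thesis using x y p q by (simp add: minus_eq_smult)
  qed
  then have "nrm A ((x \<otimes> y) \<ominus> (p \<otimes> q)) \<le> nrm A (x \<ominus> p) * nrm A y + nrm A p * nrm A (y \<ominus> q)"
    using x y p q nrm_triangle[of "(x \<ominus> p) \<otimes> y" "p \<otimes> (y \<ominus> q)"]
      nrm_mult[of "x \<ominus> p" y] nrm_mult[of p "y \<ominus> q"] by simp
  also have "\<dots> \<le> d * nrm A y + (nrm A x + 1) * nrm A (y \<ominus> q)"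
    using p q np ny x y nrm_nonneg by (intro add_mono mult_right_mono) auto
  also have "\<dots> < d * (nrm A y + 1) + (nrm A x + 1) * d'"
    using q d nx ny by (intro add_strict_mono mult_strict_left_mono) auto
  also have "\<dots> \<le> e" using d d' by simp
  finally show "\<exists>r\<in>monomial_span. nrm A ((x \<otimes> y) \<ominus> r) < e"
    using mult_in_monomial_span p q by blast
qed (use x y in simp)

text \<open>Scaling is multiplication by a multiple of the unit, so no separate estimate
  arises.\<close>

lemma closure_smult:
  assumes "x \<in> monomial_closure" shows "c \<odot> x \<in> monomial_closure"
proof -
  have "c \<odot> \<one> \<in> monomial_closure"
    by (intro span_in_closure monomial_span.smult one_in_monomial_span)
  then show ?thesis
    using closure_mult[of "c \<odot> \<one>" x] assms by (simp add: smult_mult_left)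
qed

lemma closure_star:
  assumes x: "x \<in> monomial_closure" shows "star A x \<in> monomial_closure"
  unfolding monomial_closure_def
proof (intro CollectI conjI allI impI)
  fix e :: real assume e: "e > 0"
  obtain p where p: "p \<in> monomial_span" "nrm A (x \<ominus> p) < e"
    by (rule monomial_closureD[OF x e])
  have "nrm A (star A x \<ominus> star A p) = nrm A (x \<ominus> p)"
    using x p nrm_star[of "x \<ominus> p"] by (simp add: star_minus)
  then show "\<exists>r\<in>monomial_span. nrm A (star A x \<ominus> r) < e"
    using p star_in_monomial_span by (intro bexI[of _ "star A p"]) simp_all
qed (use x in simp)

lemma closure_limit:
  assumes f: "\<And>k::nat. f k \<in> monomial_closure" and l: "l \<in> carrier A"
    and lim: "(\<lambda>k. nrm A (f k \<ominus> l)) \<longlonglongrightarrow> 0"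
  shows "l \<in> monomial_closure"
  unfolding monomial_closure_def
proof (intro CollectI conjI allI impI)
  fix e :: real assume e: "e > 0"
  obtain k where k: "nrm A (f k \<ominus> l) < e/2"
    using order_tendstoD(2)[OF lim, of "e/2"] e by (auto simp: eventually_sequentially)
  obtain p where p: "p \<in> monomial_span" "nrm A (f k \<ominus> p) < e/2"
    by (rule monomial_closureD[OF f half_gt_zero[OF e]])
  have "nrm A (l \<ominus> p) \<le> nrm A (l \<ominus> f k) + nrm A (f k \<ominus> p)"
    using l p f by (intro nrm_triangle_minus) auto
  then show "\<exists>r\<in>monomial_span. nrm A (l \<ominus> r) < e"
    using k p l f nrm_minus_commute[of l "f k"] by (intro bexI[of _ p]) auto
qed (use l in simp)

abbreviation closure_algebra :: "'a cstar"
  where "closure_algebra \<equiv> A\<lparr>carrier := monomial_closure\<rparr>"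

lemma closure_neg: "x \<in> monomial_closure \<Longrightarrow> \<ominus> x \<in> monomial_closure"
  using closure_smult[of x "-1"] by (simp add: smult_m1)

lemma ring_closure: "ring closure_algebra"
  by (intro ring.subring_is_ring[OF ring_A] ring.subringI[OF ring_A] subsetI)
    (simp_all add: closure_neg closure_mult closure_add span_in_closure one_in_monomial_span)

text \<open>Negation in a ring record is defined through its carrier, so subtraction in the smaller
  structure has to be compared with that of A; uniqueness of additive inverses does this.\<close>

lemma closure_minus:
  assumes "x \<in> monomial_closure" "y \<in> monomial_closure"
  shows "x \<ominus>\<^bsub>closure_algebra\<^esub> y = x \<ominus> y"
proof -
  have "\<ominus>\<^bsub>closure_algebra\<^esub> y = \<ominus> y"
    using abelian_group.minus_equality[OF ring.is_abelian_group[OF ring_closure], of "\<ominus> y" y] assms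
    by (simp add: closure_neg l_neg)
  then show ?thesis by (simp add: a_minus_def)
qed

lemma cstar_closure: "cstar_algebra closure_algebra"
proof -
  have "submodule monomial_closure complex_field A"
    by (rule submoduleI)
      (simp_all add: subset_iff closure_neg closure_add closure_smult span_in_closure
        zero_in_monomial_span)
  then have "module complex_field closure_algebra"
    by (rule submodule.submodule_is_module) (rule module_axioms)
  with ring_closure show ?thesis
  proof (intro cstar_algebra.intro cstar_algebra_axioms.intro, goal_cases)
    \<comment> \<open>Goal 17 is completeness: the limit exists in A, and
      \<open>closure_limit\<close> places it in the closure. The remaining axioms are inherited from
      A.\<close>
    case (17 f)
    then have cl: "f k \<in> monomial_closure" for k by simp
    obtain l where "l \<in> carrier A" "(\<lambda>k. nrm A (f k \<ominus> l)) \<longlonglongrightarrow> 0"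
      using complete[of f] 17 by (auto simp: closure_minus)
    then show ?case
      using closure_limit[OF cl] cl by (auto simp: closure_minus)
  qed (simp_all add: one_not_zero smult_mult_left smult_mult_right closure_star star_star star_add
      star_smult star_mult nrm_nonneg nrm_eq_zero nrm_triangle nrm_smult nrm_mult cstar_identity)
qed

lemma finsum_closure:
  "\<lbrakk>finite I; f \<in> I \<rightarrow> monomial_closure\<rbrakk> \<Longrightarrow> finsum closure_algebra f I = finsum A f I"
proof (induction I rule: finite_induct)
  case empty
  interpret B: ring closure_algebra by (rule ring_closure)
  show ?case by (simp add: abelian_monoid.finsum_empty[OF abelian_monoid_A])
next
  case (insert i I)
  interpret B: ring closure_algebra by (rule ring_closure)
  have "f \<in> I \<rightarrow> carrier A" "f i \<in> carrier A" using insert by (auto simp: Pi_iff)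
  then show ?case using insert by (simp add: finsum_insert)
qed

text \<open>The universal property gives a homomorphism from A into the closure that fixes the
  generators. Read as an endomorphism of A it is the identity by uniqueness, so its values, that is
  all elements of A, lie in the closure.\<close>

theorem monomials_dense: "x \<in> carrier A \<Longrightarrow> x \<in> monomial_closure"
proof -
  have "cuntz_family n closure_algebra S"
    using family S_in_monomial_span star_in_monomial_span mult_in_monomial_span
    unfolding cuntz_family_def by (simp add: span_in_closure finsum_closure)
  then obtain \<phi> where \<phi>: "\<phi> \<in> star_hom A closure_algebra" "\<forall>i\<in>{1..n}. \<phi> (S i) = S i"
    using universal[OF cstar_closure] by blast
  have mem: "\<phi> x \<in> monomial_closure" if "x \<in> carrier A" for x
    using \<phi>(1) ring_hom_closed[of \<phi> A closure_algebra x] that by (simp add: star_hom_def)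
  then have "\<phi> \<in> star_hom A A"
    using \<phi>(1) by (auto simp: star_hom_def ring_hom_def)
  then have "\<phi> = (\<lambda>x\<in>carrier A. x)"
    using universal[OF cstar_algebra_axioms family] identity_star_hom \<phi>(2) S_closed by auto
  then show "x \<in> carrier A \<Longrightarrow> x \<in> monomial_closure"
    using mem[of x] by simp
qed

end

section \<open>Permutative endomorphisms\<close>

lemma star_homD:
  assumes "\<phi> \<in> star_hom A B"
  shows star_hom_closed: "x \<in> carrier A \<Longrightarrow> \<phi> x \<in> carrier B"
    and star_hom_mult: "\<lbrakk>x \<in> carrier A; y \<in> carrier A\<rbrakk> \<Longrightarrow> \<phi> (x \<otimes>\<^bsub>A\<^esub> y) = \<phi> x \<otimes>\<^bsub>B\<^esub> \<phi> y"
    and star_hom_add: "\<lbrakk>x \<in> carrier A; y \<in> carrier A\<rbrakk> \<Longrightarrow> \<phi> (x \<oplus>\<^bsub>A\<^esub> y) = \<phi> x \<oplus>\<^bsub>B\<^esub> \<phi> y"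
    and star_hom_one: "\<phi> \<one>\<^bsub>A\<^esub> = \<one>\<^bsub>B\<^esub>"
    and star_hom_star: "x \<in> carrier A \<Longrightarrow> \<phi> (star A x) = star B (\<phi> x)"
    and star_hom_smult: "x \<in> carrier A \<Longrightarrow> \<phi> (c \<odot>\<^bsub>A\<^esub> x) = c \<odot>\<^bsub>B\<^esub> \<phi> x"
    and star_hom_extensional: "\<phi> \<in> extensional (carrier A)"
  using assms by (auto simp: star_hom_def ring_hom_def)

lemma (in cstar_algebra) star_hom_compose:
  assumes "\<phi> \<in> star_hom A A" "\<psi> \<in> star_hom A A"
  shows "compose (carrier A) \<psi> \<phi> \<in> star_hom A A"
  using star_homD[OF assms(1)] star_homD[OF assms(2)]
  by (auto simp: star_hom_def ring_hom_def compose_def)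

text \<open>The range projections sum to 1, so z is the sum of z T_i T_i^* and is determined by its
  right products with the T_i. This serves for the generators and also for their images under an
  endomorphism.\<close>

lemma (in cstar_algebra) cuntz_family_eqI:
  assumes T: "cuntz_family n A T" and x: "x \<in> carrier A" and y: "y \<in> carrier A"
    and eq: "\<And>i. i \<in> {1..n} \<Longrightarrow> x \<otimes> T i = y \<otimes> T i"
  shows "x = y"
proof -
  have expand: "z = (\<Oplus>i\<in>{1..n}. (z \<otimes> T i) \<otimes> star A (T i))" if z: "z \<in> carrier A" for z
  proof -
    have "z = z \<otimes> (\<Oplus>i\<in>{1..n}. T i \<otimes> star A (T i))" using T z by (simp add: cuntz_family_def)
    also have "\<dots> = (\<Oplus>i\<in>{1..n}. z \<otimes> (T i \<otimes> star A (T i)))"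
      using T z by (intro finsum_rdistr) (auto simp: cuntz_family_def)
    also have "\<dots> = (\<Oplus>i\<in>{1..n}. (z \<otimes> T i) \<otimes> star A (T i))"
      using T z by (intro finsum_cong') (auto simp: cuntz_family_def m_assoc)
    finally show ?thesis .
  qed
  have "(\<Oplus>i\<in>{1..n}. (x \<otimes> T i) \<otimes> star A (T i)) = (\<Oplus>i\<in>{1..n}. (y \<otimes> T i) \<otimes> star A (T i))"
    using T y eq by (intro finsum_cong') (auto simp: cuntz_family_def)
  from trans[OF trans[OF expand[OF x] this] expand[OF y, symmetric]] show ?thesis .
qed

lemma (in cstar_algebra) cuntz_family_cong:
  assumes T: "cuntz_family n A T" and eq: "\<And>i. i \<in> {1..n} \<Longrightarrow> T' i = T i"
  shows "cuntz_family n A T'"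
proof -
  have "(\<Oplus>i\<in>{1..n}. T' i \<otimes> star A (T' i)) = (\<Oplus>i\<in>{1..n}. T i \<otimes> star A (T i))"
    using T by (intro finsum_cong') (simp_all only: eq, auto simp: cuntz_family_def)
  then show ?thesis using T unfolding cuntz_family_def by (simp add: eq[simplified])
qed

lemma (in cstar_algebra) cuntz_family_unitary:
  assumes T: "cuntz_family n A T" and w: "w \<in> unitaries A"
  shows "cuntz_family n A (\<lambda>i. w \<otimes> T i)"
proof -
  have w': "w \<in> carrier A" "star A w \<otimes> w = \<one>" "w \<otimes> star A w = \<one>"
    using w by (auto simp: unitaries_def)
  have T': "\<And>i. i \<in> {1..n} \<Longrightarrow> T i \<in> carrier A" "\<And>i. i \<in> {1..n} \<Longrightarrow> star A (T i) \<otimes> T i = \<one>"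
    using T by (auto simp: cuntz_family_def)
  have "star A (w \<otimes> T i) \<otimes> (w \<otimes> T i) = \<one>" if "i \<in> {1..n}" for i
  proof -
    have "star A (w \<otimes> T i) \<otimes> (w \<otimes> T i) = star A (T i) \<otimes> (star A w \<otimes> w) \<otimes> T i"
      using T'(1)[OF that] w'(1) by (simp add: star_mult m_assoc)
    then show ?thesis using T'(1)[OF that] T'(2)[OF that] w' by simp
  qed
  moreover have "(\<Oplus>i\<in>{1..n}. w \<otimes> T i \<otimes> star A (w \<otimes> T i)) = \<one>"
  proof -
    have "(\<Oplus>i\<in>{1..n}. w \<otimes> T i \<otimes> star A (w \<otimes> T i)) = (\<Oplus>i\<in>{1..n}. w \<otimes> (T i \<otimes> star A (T i)) \<otimes> star A w)"
      using T' w' by (intro finsum_cong') (auto simp: star_mult m_assoc)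
    also have "\<dots> = w \<otimes> (\<Oplus>i\<in>{1..n}. T i \<otimes> star A (T i)) \<otimes> star A w"
      using T' w' by (simp add: finsum_ldistr finsum_rdistr Pi_def)
    finally show ?thesis using T w' by (simp add: cuntz_family_def)
  qed
  ultimately show ?thesis using T' w' by (auto simp: cuntz_family_def)
qed

lemma finite_words [simp]: "finite (words n t)"
  using finite_lists_length_eq[of "{1..n}" t] by (simp add: words_def)

lemma words_2: "\<alpha> \<in> words n 2 \<longleftrightarrow> (\<exists>x\<in>{1..n}. \<exists>y\<in>{1..n}. \<alpha> = [x, y])"
  by (auto simp: words_def length_Suc_conv numeral_2_eq_2)

text \<open>In the usual notation, \<open>on_first u\<close> is \<open>u \<otimes> 1\<close> and \<open>on_last u\<close> is \<open>1 \<otimes> u\<close> on words of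
  length three, and \<open>perm_endo_compose\<close> is \<open>\<lambda>\<^sub>u \<circ> \<lambda>\<^sub>v = \<lambda>\<^sub>w\<close> for \<open>w = \<lambda>\<^sub>u(v) u\<close>.\<close>

definition on_first :: "(nat list \<Rightarrow> nat list) \<Rightarrow> nat list \<Rightarrow> nat list"
  where "on_first u \<gamma> = u (take 2 \<gamma>) @ drop 2 \<gamma>"

definition on_last :: "(nat list \<Rightarrow> nat list) \<Rightarrow> nat list \<Rightarrow> nat list"
  where "on_last u \<gamma> = hd \<gamma> # u (tl \<gamma>)"

context cuntz_algebra
begin

text \<open>Peeling off the last letter reduces this to \<open>cuntz_family_eqI\<close>, one letter
  at a time.\<close>

lemma words_W_eqI:
  assumes "x \<in> carrier A" "y \<in> carrier A" "\<And>\<alpha>. \<alpha> \<in> words n t \<Longrightarrow> x \<otimes> W \<alpha> = y \<otimes> W \<alpha>"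
  shows "x = y"
  using assms(3)
proof (induction t)
  case 0
  then show ?case using assms(1,2) by (auto simp: words_def)
next
  case (Suc t)
  show ?case
  proof (rule Suc.IH)
    fix \<alpha> assume \<alpha>: "\<alpha> \<in> words n t"
    show "x \<otimes> W \<alpha> = y \<otimes> W \<alpha>"
    proof (rule cuntz_family_eqI[OF family])
      fix i assume i: "i \<in> {1..n}"
      have "x \<otimes> W (\<alpha> @ [i]) = y \<otimes> W (\<alpha> @ [i])"
        using \<alpha> i by (intro Suc.prems) (auto simp: words_def)
      moreover have "W (\<alpha> @ [i]) = W \<alpha> \<otimes> S i"
        using \<alpha> i by (simp add: words_def W_append W_Cons)
      ultimately show "x \<otimes> W \<alpha> \<otimes> S i = y \<otimes> W \<alpha> \<otimes> S i"
        using \<alpha> i assms(1,2) by (simp add: words_def m_assoc)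
    qed (use \<alpha> assms in \<open>auto simp: words_def\<close>)
  qed
qed

lemma W_words_closed: "\<alpha> \<in> words n t \<Longrightarrow> W \<alpha> \<in> carrier A"
  by (simp add: words_def)

lemma permutes_words:
  "\<lbrakk>u permutes words n t; \<alpha> \<in> words n t\<rbrakk> \<Longrightarrow> u \<alpha> \<in> words n t"
  by (simp add: permutes_in_image)

text \<open>Orthogonality of words of equal length leaves a single summand. The choice g =
  \<open>id\<close> evaluates a permutation unitary on words, the choice g = u its adjoint.\<close>

lemma matrix_units_mult_W:
  assumes f: "\<And>\<beta>. \<beta> \<in> words n t \<Longrightarrow> f \<beta> \<in> carrier A"
    and g: "g permutes words n t" and \<alpha>: "\<alpha> \<in> words n t"
  shows "(\<Oplus>\<beta>\<in>words n t. f \<beta> \<otimes> star A (W (g \<beta>))) \<otimes> W (g \<alpha>) = f \<alpha>"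
proof -
  have "(\<Oplus>\<beta>\<in>words n t. f \<beta> \<otimes> star A (W (g \<beta>))) \<otimes> W (g \<alpha>)
      = (\<Oplus>\<beta>\<in>words n t. f \<beta> \<otimes> star A (W (g \<beta>)) \<otimes> W (g \<alpha>))"
    using f W_words_closed[OF permutes_words[OF g]] \<alpha> by (intro finsum_ldistr) auto
  also have "\<dots> = (\<Oplus>\<beta>\<in>words n t. if \<alpha> = \<beta> then f \<beta> else \<zero>)"
  proof (intro finsum_cong' refl)
    fix \<beta> assume \<beta>: "\<beta> \<in> words n t"
    have "star A (W (g \<beta>)) \<otimes> W (g \<alpha>) = (if g \<beta> = g \<alpha> then \<one> else \<zero>)"
      using permutes_words[OF g \<alpha>] permutes_words[OF g \<beta>] by (intro star_W_W) (auto simp: words_def)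
    also have "\<dots> = (if \<alpha> = \<beta> then \<one> else \<zero>)"
      using permutes_inj[OF g] by (auto dest: injD)
    finally show "f \<beta> \<otimes> star A (W (g \<beta>)) \<otimes> W (g \<alpha>) = (if \<alpha> = \<beta> then f \<beta> else \<zero>)"
      using f[OF \<beta>] W_words_closed[OF permutes_words[OF g \<alpha>]] W_words_closed[OF permutes_words[OF g \<beta>]]
      by (simp add: m_assoc)
  qed (use f in auto)
  also have "\<dots> = f \<alpha>" using f \<alpha> by (intro finsum_singleton) auto
  finally show ?thesis .
qed

lemma perm_unitary_closed [simp]:
  "u permutes words n t \<Longrightarrow> perm_unitary n A S t u \<in> carrier A"
  unfolding perm_unitary_def using W_words_closed W_words_closed[OF permutes_words]
  by (intro finsum_closed) auto

lemma perm_unitary_W: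
  assumes u: "u permutes words n t" and \<alpha>: "\<alpha> \<in> words n t"
  shows "perm_unitary n A S t u \<otimes> W \<alpha> = W (u \<alpha>)"
  using matrix_units_mult_W[OF _ permutes_id \<alpha>, of "\<lambda>\<beta>. W (u \<beta>)"]
    W_words_closed[OF permutes_words[OF u]]
  by (simp add: perm_unitary_def)

lemma star_perm_unitary_W:
  assumes u: "u permutes words n t" and \<alpha>: "\<alpha> \<in> words n t"
  shows "star A (perm_unitary n A S t u) \<otimes> W (u \<alpha>) = W \<alpha>"
proof -
  have "star A (perm_unitary n A S t u) = (\<Oplus>\<beta>\<in>words n t. star A (W (u \<beta>) \<otimes> star A (W \<beta>)))"
    unfolding perm_unitary_def using W_words_closed W_words_closed[OF permutes_words[OF u]]
    by (intro star_finsum) auto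
  also have "\<dots> = (\<Oplus>\<beta>\<in>words n t. W \<beta> \<otimes> star A (W (u \<beta>)))"
    using W_words_closed W_words_closed[OF permutes_words[OF u]]
    by (intro finsum_cong') (auto simp: star_mult star_star)
  finally show ?thesis using matrix_units_mult_W[OF W_words_closed u \<alpha>] by simp
qed

lemma perm_unitary_unitary:
  assumes u: "u permutes words n t"
  shows "perm_unitary n A S t u \<in> unitaries A"
proof -
  let ?w = "perm_unitary n A S t u"
  note w = perm_unitary_closed[OF u]
  have "star A ?w \<otimes> ?w = \<one>"
  proof (rule words_W_eqI[of _ _ t])
    fix \<alpha> assume \<alpha>: "\<alpha> \<in> words n t"
    show "star A ?w \<otimes> ?w \<otimes> W \<alpha> = \<one> \<otimes> W \<alpha>"
      using w \<alpha> W_words_closed[OF \<alpha>]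
      by (simp add: m_assoc perm_unitary_W[OF u] star_perm_unitary_W[OF u])
  qed (use w in auto)
  moreover have "?w \<otimes> star A ?w = \<one>"
  proof (rule words_W_eqI[of _ _ t])
    fix \<alpha> assume "\<alpha> \<in> words n t"
    then obtain \<beta> where \<beta>: "\<beta> \<in> words n t" "\<alpha> = u \<beta>"
      using permutes_image[OF u] by blast
    then show "?w \<otimes> star A ?w \<otimes> W \<alpha> = \<one> \<otimes> W \<alpha>"
      using w W_words_closed[OF \<beta>(1)] W_words_closed[OF permutes_words[OF u \<beta>(1)]]
      by (simp add: m_assoc perm_unitary_W[OF u] star_perm_unitary_W[OF u])
  qed (use w in auto)
  ultimately show ?thesis using w by (simp add: unitaries_def)
qed

section \<open>Endomorphisms attached to unitaries, and their composition\<close>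

text \<open>The w S_i form a Cuntz family in A, so the universal property with A as its own target
  makes the description in \<open>cuntz_endo\<close> well defined.\<close>

lemma cuntz_endo_props:
  assumes "w \<in> unitaries A"
  shows cuntz_endo_star_hom: "cuntz_endo n A S w \<in> star_hom A A"
    and cuntz_endo_S: "i \<in> {1..n} \<Longrightarrow> cuntz_endo n A S w (S i) = w \<otimes> S i"
    and cuntz_endo_unique:
      "\<lbrakk>\<phi> \<in> star_hom A A; \<And>i. i \<in> {1..n} \<Longrightarrow> \<phi> (S i) = w \<otimes> S i\<rbrakk> \<Longrightarrow> \<phi> = cuntz_endo n A S w"
proof -
  have ex1: "\<exists>!\<phi>. \<phi> \<in> star_hom A A \<and> (\<forall>i\<in>{1..n}. \<phi> (S i) = w \<otimes> S i)"
    by (rule universal[OF cstar_algebra_axioms cuntz_family_unitary[OF family assms]])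
  from theI'[OF this]
  have the: "cuntz_endo n A S w \<in> star_hom A A \<and> (\<forall>i\<in>{1..n}. cuntz_endo n A S w (S i) = w \<otimes> S i)"
    unfolding cuntz_endo_def .
  then show "cuntz_endo n A S w \<in> star_hom A A"
    "i \<in> {1..n} \<Longrightarrow> cuntz_endo n A S w (S i) = w \<otimes> S i" by auto
  show "\<phi> = cuntz_endo n A S w"
    if "\<phi> \<in> star_hom A A" "\<And>i. i \<in> {1..n} \<Longrightarrow> \<phi> (S i) = w \<otimes> S i"
    using ex1 the that by blast
qed

context
  fixes u
  assumes u: "u permutes words n 2"
begin

lemma perm_endo_star_hom: "perm_endo n A S 2 u \<in> star_hom A A"
  unfolding perm_endo_def by (rule cuntz_endo_star_hom[OF perm_unitary_unitary[OF u]])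

lemma perm_endo_closed [simp]: "x \<in> carrier A \<Longrightarrow> perm_endo n A S 2 u x \<in> carrier A"
  by (rule star_hom_closed[OF perm_endo_star_hom])

text \<open>This supplies a second family against which equalities can be tested by
  \<open>cuntz_family_eqI\<close>.\<close>

lemma perm_endo_family: "cuntz_family n A (\<lambda>i. perm_endo n A S 2 u (S i))"
proof -
  have "perm_endo n A S 2 u (S i) = perm_unitary n A S 2 u \<otimes> S i" if "i \<in> {1..n}" for i
    unfolding perm_endo_def by (rule cuntz_endo_S[OF perm_unitary_unitary[OF u] that])
  then show ?thesis
    by (rule cuntz_family_cong[OF cuntz_family_unitary[OF family perm_unitary_unitary[OF u]]])
qed

lemma perm_endo_S_S:
  assumes "x \<in> {1..n}" "y \<in> {1..n}"
  shows "perm_endo n A S 2 u (S x) \<otimes> S y = W (u [x, y])"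
proof -
  have "perm_endo n A S 2 u (S x) \<otimes> S y = perm_unitary n A S 2 u \<otimes> W [x, y]"
    using assms u by (simp add: perm_endo_def cuntz_endo_S perm_unitary_unitary W_Cons m_assoc)
  then show ?thesis using perm_unitary_W[OF u, of "[x, y]"] assms words_2 by auto
qed

lemma perm_endo_unique:
  assumes \<phi>: "\<phi> \<in> star_hom A A"
    and eq: "\<And>x y. \<lbrakk>x \<in> {1..n}; y \<in> {1..n}\<rbrakk> \<Longrightarrow> \<phi> (S x) \<otimes> S y = W (u [x, y])"
  shows "\<phi> = perm_endo n A S 2 u"
  unfolding perm_endo_def
proof (rule cuntz_endo_unique[OF perm_unitary_unitary[OF u] \<phi>])
  fix x assume x: "x \<in> {1..n}"
  show "\<phi> (S x) = perm_unitary n A S 2 u \<otimes> S x"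
  proof (rule cuntz_family_eqI[OF family])
    fix y assume y: "y \<in> {1..n}"
    have "perm_unitary n A S 2 u \<otimes> S x \<otimes> S y = perm_unitary n A S 2 u \<otimes> W [x, y]"
      using x y u by (simp add: W_Cons m_assoc)
    then show "\<phi> (S x) \<otimes> S y = perm_unitary n A S 2 u \<otimes> S x \<otimes> S y"
      using perm_unitary_W[OF u, of "[x, y]"] eq x y words_2 by auto
  qed (use x u star_hom_closed[OF \<phi>] in auto)
qed

end

lemma perm_endo_compose:
  assumes u: "u permutes words n 2" and v: "v permutes words n 2" and w: "w permutes words n 2"
    and eq: "\<And>\<gamma>. \<gamma> \<in> words n 3 \<Longrightarrow>
      on_first w (on_last u \<gamma>) = on_first u (on_last u (on_first v \<gamma>))"
  shows "compose (carrier A) (perm_endo n A S 2 u) (perm_endo n A S 2 v) = perm_endo n A S 2 w"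
proof -
  let ?e = "perm_endo n A S 2"
  have eW: "?e f (S x) \<otimes> W \<alpha> = W (on_first f (x # \<alpha>))"
    if f: "f permutes words n 2" and x: "x \<in> {1..n}" and \<alpha>: "\<alpha> \<in> words n 2" for f x \<alpha>
  proof -
    obtain y z where yz: "y \<in> {1..n}" "z \<in> {1..n}" "\<alpha> = [y, z]" using \<alpha> words_2 by auto
    have "[x, y] \<in> words n 2" using x yz words_2 by auto
    then have fw: "f [x, y] \<in> words n 2" by (rule permutes_words[OF f])
    have "?e f (S x) \<otimes> W \<alpha> = ?e f (S x) \<otimes> S y \<otimes> S z"
      using x yz perm_endo_closed[OF f] by (simp add: W_Cons m_assoc)
    also have "\<dots> = W (f [x, y]) \<otimes> W [z]"
      using x yz f by (simp add: perm_endo_S_S W_Cons)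
    also have "\<dots> = W (f [x, y] @ [z])"
      using fw yz by (subst W_append) (auto simp: words_def)
    finally show ?thesis using yz by (simp add: on_first_def)
  qed
  have wS: "?e w (S x) = ?e u (?e v (S x))" if x: "x \<in> {1..n}" for x
  \<comment> \<open>Testing against lambda_u(S_y) instead of S_y gives the right side the form
    lambda_u(lambda_v(S_x) S_y), which is lambda_u of a word. After one more factor S_z both sides
    are words of length three, matched by \<open>eq\<close>; this is why \<open>on_last u\<close>
    stands on the left side of \<open>eq\<close>.\<close>
  proof (rule cuntz_family_eqI[OF perm_endo_family[OF u]])
    fix y assume y: "y \<in> {1..n}"
    show "?e w (S x) \<otimes> ?e u (S y) = ?e u (?e v (S x)) \<otimes> ?e u (S y)"
    proof (rule cuntz_family_eqI[OF family])
      fix z assume z: "z \<in> {1..n}"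
      have yz: "[y, z] \<in> words n 2" and xy: "[x, y] \<in> words n 2" using x y z words_2 by auto
      obtain p q where pq: "p \<in> {1..n}" "q \<in> {1..n}" "v [x, y] = [p, q]"
        using permutes_words[OF v xy] words_2 by auto
      have qz: "[q, z] \<in> words n 2" using pq z words_2 by auto
      have "?e w (S x) \<otimes> ?e u (S y) \<otimes> S z = ?e w (S x) \<otimes> W (u [y, z])"
        using x y z perm_endo_closed[OF u] perm_endo_closed[OF w] u
        by (simp add: m_assoc perm_endo_S_S)
      also have "\<dots> = W (on_first w (on_last u [x, y, z]))"
        using eW[OF w x permutes_words[OF u yz]] by (simp add: on_last_def)
      also have "\<dots> = W (on_first u (on_last u (on_first v [x, y, z])))"
        using x y z by (subst eq) (auto simp: words_def)
      also have "\<dots> = ?e u (S p) \<otimes> W (u [q, z])"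
        using eW[OF u pq(1) permutes_words[OF u qz]] pq by (simp add: on_first_def on_last_def)
      also have "\<dots> = ?e u (S p) \<otimes> ?e u (S q) \<otimes> S z"
        using pq z perm_endo_closed[OF u] u by (simp add: m_assoc perm_endo_S_S)
      also have "?e u (S p) \<otimes> ?e u (S q) = ?e u (?e v (S x) \<otimes> S y)"
        using pq x y v star_hom_mult[OF perm_endo_star_hom[OF u]]
        by (simp add: perm_endo_S_S W_Cons)
      also have "\<dots> = ?e u (?e v (S x)) \<otimes> ?e u (S y)"
        using x y perm_endo_closed[OF v] by (simp add: star_hom_mult[OF perm_endo_star_hom[OF u]])
      finally show "?e w (S x) \<otimes> ?e u (S y) \<otimes> S z = ?e u (?e v (S x)) \<otimes> ?e u (S y) \<otimes> S z" .
    qed (use x y perm_endo_closed[OF u] perm_endo_closed[OF v] perm_endo_closed[OF w] in auto)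
  qed (use x perm_endo_closed[OF u] perm_endo_closed[OF v] perm_endo_closed[OF w] in auto)
  show ?thesis
  proof (rule perm_endo_unique[OF w])
    show "compose (carrier A) (?e u) (?e v) \<in> star_hom A A"
      by (rule star_hom_compose[OF perm_endo_star_hom[OF v] perm_endo_star_hom[OF u]])
    show "compose (carrier A) (?e u) (?e v) (S x) \<otimes> S y = W (w [x, y])"
      if "x \<in> {1..n}" "y \<in> {1..n}" for x y
      using that perm_endo_S_S[OF w that] wS[OF that(1)] by (simp add: compose_def)
  qed
qed

lemma perm_endo_id: "perm_endo n A S 2 id = (\<lambda>x\<in>carrier A. x)"
  by (rule perm_endo_unique[symmetric, OF permutes_id identity_star_hom]) (simp add: W_Cons)

end

section \<open>Rigidity of intertwiners\<close>

context cuntz_algebra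
begin

section \<open>Compression by one generator\<close>

definition compress :: "nat \<Rightarrow> 'a \<Rightarrow> 'a"
  where "compress j x = star A (S j) \<otimes> x \<otimes> S j"

text \<open>This contains the span of 1 and the powers of S_j and S_j^*, but records only two
  features: its elements survive further compressions, and the constant term is separated from terms
  that begin with S_j or end with S_j^*.\<close>

definition corner_fixed :: "nat \<Rightarrow> 'a set"
  where "corner_fixed j = {t \<in> carrier A. compress j t = t \<and>
    (\<exists>c. \<exists>a\<in>carrier A. \<exists>b\<in>carrier A. t = c \<odot> \<one> \<oplus> S j \<otimes> a \<oplus> b \<otimes> star A (S j))}"

lemma corner_fixedI:
  assumes "compress j t = t" "a \<in> carrier A" "b \<in> carrier A" "j \<in> {1..n}"
    and "t = c \<odot> \<one> \<oplus> S j \<otimes> a \<oplus> b \<otimes> star A (S j)"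
  shows "t \<in> corner_fixed j"
proof -
  have "t \<in> carrier A" unfolding assms(5) using assms(2-4) by simp
  then show ?thesis unfolding corner_fixed_def using assms by blast
qed

lemma corner_fixedE:
  assumes "t \<in> corner_fixed j"
  obtains c a b where "compress j t = t" "t \<in> carrier A" "a \<in> carrier A" "b \<in> carrier A"
    "t = c \<odot> \<one> \<oplus> S j \<otimes> a \<oplus> b \<otimes> star A (S j)"
proof -
  from assms have t: "t \<in> carrier A" "compress j t = t" and
    "\<exists>c. \<exists>a\<in>carrier A. \<exists>b\<in>carrier A. t = c \<odot> \<one> \<oplus> S j \<otimes> a \<oplus> b \<otimes> star A (S j)"
    unfolding corner_fixed_def by simp_all
  then show thesis using that t by (elim exE bexE)
qed

context
  fixes j
  assumes j: "j \<in> {1..n}"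
begin

lemma compress_closed [simp]: "x \<in> carrier A \<Longrightarrow> compress j x \<in> carrier A"
  using j by (simp add: compress_def)

lemma compress_add:
  "\<lbrakk>x \<in> carrier A; y \<in> carrier A\<rbrakk> \<Longrightarrow> compress j (x \<oplus> y) = compress j x \<oplus> compress j y"
  using j by (simp add: compress_def l_distr r_distr)

lemma compress_smult: "x \<in> carrier A \<Longrightarrow> compress j (c \<odot> x) = c \<odot> compress j x"
  using j by (simp add: compress_def smult_mult_left smult_mult_right)

lemma compress_star: "x \<in> carrier A \<Longrightarrow> compress j (star A x) = star A (compress j x)"
  using j by (simp add: compress_def star_mult star_star m_assoc)

lemma nrm_S: "i \<in> {1..n} \<Longrightarrow> nrm A (S i) = 1"
  by (rule nrm_isometry) (simp_all add: star_S_S)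

lemma nrm_compress: 
  assumes "x \<in> carrier A" shows "nrm A (compress j x) \<le> nrm A x"
proof -
  have "nrm A (compress j x) \<le> nrm A (star A (S j) \<otimes> x)"
    unfolding compress_def using assms j nrm_S[OF j] by (intro nrm_contract_right) auto
  also have "\<dots> \<le> nrm A x"
    using assms j nrm_S[OF j] by (intro nrm_contract_left) auto
  finally show ?thesis .
qed

lemma compress_pow:
  assumes "x \<in> carrier A"
  shows compress_pow_closed: "(compress j ^^ M) x \<in> carrier A"
    and compress_pow_smult: "(compress j ^^ M) (c \<odot> x) = c \<odot> (compress j ^^ M) x"
    and compress_pow_star: "(compress j ^^ M) (star A x) = star A ((compress j ^^ M) x)"
    and nrm_compress_pow: "nrm A ((compress j ^^ M) x) \<le> nrm A x"
proof -
  show cl: "(compress j ^^ M) x \<in> carrier A" for M using assms by (induction M) auto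
  show "(compress j ^^ M) (c \<odot> x) = c \<odot> (compress j ^^ M) x"
    using assms cl by (induction M) (auto simp: compress_smult)
  show "(compress j ^^ M) (star A x) = star A ((compress j ^^ M) x)"
    using assms cl by (induction M) (auto simp: compress_star)
  show "nrm A ((compress j ^^ M) x) \<le> nrm A x"
  proof (induction M)
    case (Suc M)
    then show ?case using nrm_compress[OF cl[of M]] by simp
  qed simp
qed

lemma compress_pow_add:
  assumes "x \<in> carrier A" "y \<in> carrier A"
  shows "(compress j ^^ M) (x \<oplus> y) = (compress j ^^ M) x \<oplus> (compress j ^^ M) y"
  using assms compress_pow_closed by (induction M) (auto simp: compress_add)

lemma corner_fixed_add:
  assumes "t \<in> corner_fixed j" "t' \<in> corner_fixed j"
  shows "t \<oplus> t' \<in> corner_fixed j"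
proof -
  obtain c a b where t: "compress j t = t" "t \<in> carrier A" "a \<in> carrier A" "b \<in> carrier A"
    "t = c \<odot> \<one> \<oplus> S j \<otimes> a \<oplus> b \<otimes> star A (S j)" by (rule corner_fixedE[OF assms(1)])
  obtain c' a' b' where t': "compress j t' = t'" "t' \<in> carrier A" "a' \<in> carrier A" "b' \<in> carrier A"
    "t' = c' \<odot> \<one> \<oplus> S j \<otimes> a' \<oplus> b' \<otimes> star A (S j)" by (rule corner_fixedE[OF assms(2)])
  show ?thesis
  proof (rule corner_fixedI[OF _ _ _ j])
    show "compress j (t \<oplus> t') = t \<oplus> t'" using t(1,2) t'(1,2) by (simp add: compress_add)
    show "t \<oplus> t' = (c + c') \<odot> \<one> \<oplus> S j \<otimes> (a \<oplus> a') \<oplus> (b \<oplus> b') \<otimes> star A (S j)"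
      using t(3,4) t'(3,4) j by (simp add: t(5) t'(5) smult_add_left l_distr r_distr a_ac)
  qed (use t(3,4) t'(3,4) in auto)
qed

lemma corner_fixed_smult:
  assumes "t \<in> corner_fixed j"
  shows "d \<odot> t \<in> corner_fixed j"
proof -
  obtain c a b where t: "compress j t = t" "t \<in> carrier A" "a \<in> carrier A" "b \<in> carrier A"
    "t = c \<odot> \<one> \<oplus> S j \<otimes> a \<oplus> b \<otimes> star A (S j)" by (rule corner_fixedE[OF assms(1)])
  show ?thesis
  proof (rule corner_fixedI[OF _ _ _ j])
    show "compress j (d \<odot> t) = d \<odot> t" using t(1,2) by (simp add: compress_smult)
    show "d \<odot> t = (d * c) \<odot> \<one> \<oplus> S j \<otimes> (d \<odot> a) \<oplus> (d \<odot> b) \<otimes> star A (S j)"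
      using t(3,4) j
      by (simp add: t(5) smult_add_right smult_smult smult_mult_left smult_mult_right)
  qed (use t(3,4) in auto)
qed

lemma corner_fixed_star:
  assumes "t \<in> corner_fixed j"
  shows "star A t \<in> corner_fixed j"
proof -
  obtain c a b where t: "compress j t = t" "t \<in> carrier A" "a \<in> carrier A" "b \<in> carrier A"
    "t = c \<odot> \<one> \<oplus> S j \<otimes> a \<oplus> b \<otimes> star A (S j)" by (rule corner_fixedE[OF assms(1)])
  show ?thesis
  proof (rule corner_fixedI[OF _ _ _ j])
    show "compress j (star A t) = star A t" using t(1,2) by (simp add: compress_star)
    show "star A t = cnj c \<odot> \<one> \<oplus> S j \<otimes> star A b \<oplus> star A a \<otimes> star A (S j)"
      using t(3,4) j by (simp add: t(5) star_add star_smult star_mult star_star a_ac)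
  qed (use t(3,4) in auto)
qed

lemma zero_corner_fixed: "\<zero> \<in> corner_fixed j"
  using j by (intro corner_fixedI[of j \<zero> \<zero> \<zero> 0]) (auto simp: compress_def)

lemma compress_pow_fixed: "t \<in> corner_fixed j \<Longrightarrow> (compress j ^^ M) t = t"
  by (induction M) (auto simp: corner_fixed_def)

lemma compress_word_Cons:
  assumes "i \<in> {1..n}" "set \<gamma> \<subseteq> {1..n}"
  shows "compress j (W (i # \<gamma>)) = (if i = j then W (\<gamma> @ [j]) else \<zero>)"
proof -
  have "compress j (W (i # \<gamma>)) = (star A (S j) \<otimes> S i) \<otimes> (W \<gamma> \<otimes> S j)"
    using assms j by (simp add: compress_def W_Cons m_assoc)
  then show ?thesis using assms j star_S_S[of j i] by (auto simp: W_append W_Cons)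
qed

lemma W_replicate_corner_fixed: "W (replicate k j) \<in> corner_fixed j"
proof (cases k)
  case 0
  show ?thesis
    by (rule corner_fixedI[of j _ \<zero> \<zero> 1]) (use 0 j star_S_S[OF j j] in \<open>auto simp: compress_def\<close>)
next
  case (Suc m)
  have r: "set (replicate m j) \<subseteq> {1..n}" using j by auto
  show ?thesis
  proof (rule corner_fixedI[of j _ "W (replicate m j)" \<zero> 0])
    show "compress j (W (replicate k j)) = W (replicate k j)"
      using compress_word_Cons[OF j r] Suc by (simp add: replicate_append_same)
    show "W (replicate k j) = 0 \<odot> \<one> \<oplus> S j \<otimes> W (replicate m j) \<oplus> \<zero> \<otimes> star A (S j)"
      using Suc r j W_closed[OF r] by (simp add: W_Cons)
  qed (use r j W_closed[OF r] in auto)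
qed

lemma compress_pow_Suc_mem: "(compress j ^^ M) (compress j x) \<in> F \<Longrightarrow> \<exists>M. (compress j ^^ M) x \<in> F"
  by (rule exI[of _ "Suc M"]) (simp add: funpow_swap1)

text \<open>Compression moves a leading j to the back and kills a word with another first letter.
  The suffix counts the letters moved so far, so the induction consumes the word until zero or a
  power of S_j is left.\<close>

lemma compress_word_eventually:
  "set \<alpha> \<subseteq> {1..n} \<Longrightarrow> \<exists>M. (compress j ^^ M) (W (\<alpha> @ replicate k j)) \<in> corner_fixed j"
proof (induction \<alpha> arbitrary: k)
  case Nil
  then show ?case using W_replicate_corner_fixed by (auto intro!: exI[of _ 0])
next
  case (Cons i \<alpha>)
  have set: "set (\<alpha> @ replicate k j) \<subseteq> {1..n}" using Cons.prems j by auto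
  show ?case
  proof (cases "i = j")
    case True
    have "(\<alpha> @ replicate k j) @ [j] = \<alpha> @ replicate (Suc k) j"
      by (simp add: replicate_append_same)
    then have "compress j (W ((i # \<alpha>) @ replicate k j)) = W (\<alpha> @ replicate (Suc k) j)"
      using compress_word_Cons[OF _ set, of i] True j by simp
    moreover obtain M where "(compress j ^^ M) (W (\<alpha> @ replicate (Suc k) j)) \<in> corner_fixed j"
      using Cons.IH[of "Suc k"] Cons.prems by auto
    ultimately show ?thesis using compress_pow_Suc_mem by metis
  next
    case False
    then have "compress j (W ((i # \<alpha>) @ replicate k j)) = \<zero>"
      using compress_word_Cons[OF _ set, of i] Cons.prems by simp
    then show ?thesis using zero_corner_fixed by (intro exI[of _ 1]) simp
  qed
qed

text \<open>Compression strips the first letters of both words, or gives zero, until one of the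
  words is empty; the other one is then covered by \<open>compress_word_eventually\<close>.\<close>

lemma compress_monomial_eventually:
  "\<lbrakk>set \<alpha> \<subseteq> {1..n}; set \<beta> \<subseteq> {1..n}\<rbrakk> \<Longrightarrow>
    \<exists>M. (compress j ^^ M) (W \<alpha> \<otimes> star A (W \<beta>)) \<in> corner_fixed j"
proof (induction \<alpha> arbitrary: \<beta>)
  case Nil
  obtain M where "(compress j ^^ M) (W \<beta>) \<in> corner_fixed j"
    using compress_word_eventually[of \<beta> 0] Nil by auto
  then show ?case
    using Nil corner_fixed_star by (intro exI[of _ M]) (simp add: compress_pow_star)
next
  case (Cons i \<alpha>)
  show ?case
  proof (cases \<beta>)
    case Nil
    then show ?thesis using compress_word_eventually[of "i # \<alpha>" 0] Cons.prems by simp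
  next
    case (Cons k \<gamma>)
    note prems = Cons.prems[unfolded Cons]
    have "compress j (W (i # \<alpha>) \<otimes> star A (W \<beta>))
        = (star A (S j) \<otimes> S i) \<otimes> (W \<alpha> \<otimes> star A (W \<gamma>)) \<otimes> (star A (S k) \<otimes> S j)"
      using prems Cons j by (simp add: compress_def W_Cons star_mult m_assoc)
    then have eq: "compress j (W (i # \<alpha>) \<otimes> star A (W \<beta>))
        = (if i = j \<and> k = j then W \<alpha> \<otimes> star A (W \<gamma>) else \<zero>)"
      using prems j star_S_S[of j i] star_S_S[of k j] by auto
    show ?thesis
    proof (cases "i = j \<and> k = j")
      case True
      moreover obtain M where "(compress j ^^ M) (W \<alpha> \<otimes> star A (W \<gamma>)) \<in> corner_fixed j"
        using Cons.IH[of \<gamma>] prems by auto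
      ultimately show ?thesis using eq compress_pow_Suc_mem by metis
    next
      case False
      then have "compress j (W (i # \<alpha>) \<otimes> star A (W \<beta>)) = \<zero>" by (simp only: eq if_False)
      then show ?thesis using zero_corner_fixed by (intro exI[of _ 1]) simp
    qed
  qed
qed

lemma compress_span_eventually:
  "x \<in> monomial_span \<Longrightarrow> \<exists>M. (compress j ^^ M) x \<in> corner_fixed j"
proof (induction rule: monomial_span.induct)
  case (monomial \<alpha> \<beta>)
  then show ?case by (rule compress_monomial_eventually)
next
  case (add x y)
  then obtain M N where MN: "(compress j ^^ M) x \<in> corner_fixed j" "(compress j ^^ N) y \<in> corner_fixed j"
    by blast
  \<comment> \<open>Elements of \<open>corner_fixed j\<close> are fixed by further compressions, so
    both exponents can be raised to their sum.\<close>
  have x: "(compress j ^^ (N + M)) x \<in> corner_fixed j"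
    using MN by (simp add: funpow_add compress_pow_fixed)
  have "(compress j ^^ (M + N)) y \<in> corner_fixed j"
    using MN by (simp add: funpow_add compress_pow_fixed)
  then have "(compress j ^^ (N + M)) y \<in> corner_fixed j" by (simp add: add.commute)
  then have "(compress j ^^ (N + M)) (x \<oplus> y) \<in> corner_fixed j"
    using x add corner_fixed_add by (simp add: compress_pow_add)
  then show ?case ..
next
  case (smult x c)
  then obtain M where "(compress j ^^ M) x \<in> corner_fixed j" by blast
  then have "(compress j ^^ M) (c \<odot> x) \<in> corner_fixed j"
    using smult corner_fixed_smult by (simp add: compress_pow_smult)
  then show ?case ..
qed

text \<open>A polynomial close to x reaches \<open>corner_fixed j\<close> after finitely many
  compressions, and compressions do not increase the distance.\<close>

lemma compress_approx:
  assumes x: "x \<in> carrier A" and e: "e > 0"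
  obtains M c a b where "a \<in> carrier A" "b \<in> carrier A"
    "nrm A ((compress j ^^ Suc M) x \<ominus> (c \<odot> \<one> \<oplus> S j \<otimes> a \<oplus> b \<otimes> star A (S j))) < e"
proof -
  obtain p where p: "p \<in> monomial_span" "nrm A (x \<ominus> p) < e"
    by (rule monomial_closureD[OF monomials_dense[OF x] e])
  obtain M where "(compress j ^^ M) p \<in> corner_fixed j"
    using compress_span_eventually[OF p(1)] by blast
  \<comment> \<open>The exponent is made positive because the first compression takes an intertwiner
    v to V v; it is V v that the later ones fix.\<close>
  then have M: "(compress j ^^ Suc M) p \<in> corner_fixed j"
    using compress_pow_fixed[of "(compress j ^^ M) p" 1] by simp
  obtain c a b where t: "a \<in> carrier A" "b \<in> carrier A"
    "(compress j ^^ Suc M) p = c \<odot> \<one> \<oplus> S j \<otimes> a \<oplus> b \<otimes> star A (S j)"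
    by (rule corner_fixedE[OF M])
  have "(compress j ^^ Suc M) x \<ominus> (compress j ^^ Suc M) p = (compress j ^^ Suc M) (x \<ominus> p)"
    using x p compress_pow_closed[of _ "Suc M"] compress_pow_add[of x "(-1) \<odot> p" "Suc M"]
      compress_pow_smult[of p "Suc M"]
    by (simp add: minus_eq_smult del: funpow.simps)
  then have "nrm A ((compress j ^^ Suc M) x \<ominus> (compress j ^^ Suc M) p) < e"
    using nrm_compress_pow[of "x \<ominus> p" "Suc M"] x p by (simp del: funpow.simps)
  then show thesis using that[OF t(1,2)] unfolding t(3) by blast
qed

end

text \<open>If a unitary \<open>v\<close> satisfies \<open>v S\<^sub>j = S\<^sub>j V v\<close> with \<open>V S\<^sub>j = S\<^sub>j\<close>, then compressing by
  powers of \<open>S\<^sub>j\<close> fixes \<open>V v\<close> and approximates it by \<open>c 1 + S\<^sub>j a + b S\<^sub>j\<^sup>*\<close>; the last two terms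
  are killed by \<open>v = \<lambda>\<^sub>u(S\<^sub>x)\<^sup>* v S\<^sub>x\<close>.\<close>

context
  fixes u v j f x y
  assumes u: "u permutes words n 2" and v: "v \<in> unitaries A" and j: "j \<in> {1..n}"
    and vj: "v \<otimes> S j = perm_endo n A S 2 u (S j) \<otimes> v"
    and row: "\<And>z. z \<in> {1..n} \<Longrightarrow> u [j, z] = [j, f z]" and fj: "f j = j"
    and x: "x \<in> {1..n}" and vx: "v \<otimes> S x = perm_endo n A S 2 u (S x) \<otimes> v"
    and off: "\<And>z. z \<in> {1..n} \<Longrightarrow> hd (u [x, z]) \<noteq> j"
    and y: "y \<in> {1..n}" and fy: "f y = x"
begin

lemma v_closed: "v \<in> carrier A" and v_star: "star A v \<otimes> v = \<one>" "v \<otimes> star A v = \<one>"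
  using v by (auto simp: unitaries_def)

lemma intertwiner_approx:
  assumes e: "e > 0"
  obtains c where "nrm A (v \<ominus> c \<odot> (star A (perm_endo n A S 2 u (S x)) \<otimes> S y)) < e"
proof -
  let ?e = "perm_endo n A S 2 u"
  note [simp] = v_closed
  have ec [simp]: "i \<in> {1..n} \<Longrightarrow> ?e (S i) \<in> carrier A" for i
    using perm_endo_closed[OF u] by simp
  have iso: "star A (?e (S i)) \<otimes> ?e (S i) = \<one>" if "i \<in> {1..n}" for i
    by (rule cuntz_family_isometry[OF perm_endo_family[OF u] that])
  have xj: "x \<noteq> j" using off[OF j] row[OF j] by auto
  have uw: "u [i, z] \<in> words n 2" if "i \<in> {1..n}" "z \<in> {1..n}" for i z
    using that permutes_words[OF u, of "[i, z]"] words_2 by auto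
  have f: "f z \<in> {1..n}" if "z \<in> {1..n}" for z
    using uw[OF j that] row[OF that] by (auto simp: words_def)
  \<comment> \<open>V is what follows the initial S_j in lambda_u(S_j). From the left it takes S_z
    to S_(f z).\<close>
  define V where "V = star A (S j) \<otimes> ?e (S j)"
  have V [simp]: "V \<in> carrier A" using j by (simp add: V_def)
  have VS: "V \<otimes> S z = S (f z)" if z: "z \<in> {1..n}" for z
  proof -
    have "V \<otimes> S z = star A (S j) \<otimes> W (u [j, z])"
      using z j perm_endo_S_S[OF u j z] by (simp add: V_def m_assoc)
    also have "\<dots> = (star A (S j) \<otimes> S j) \<otimes> S (f z)"
      using f[OF z] j row[OF z] by (simp add: W_Cons m_assoc)
    finally show ?thesis using j star_S_S[OF j j] f[OF z] by simp
  qed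
  have eSj: "?e (S j) = S j \<otimes> V"
  proof (rule cuntz_family_eqI[OF family])
    show "?e (S j) \<otimes> S z = S j \<otimes> V \<otimes> S z" if z: "z \<in> {1..n}" for z
      using z j perm_endo_S_S[OF u j z] VS[OF z] row[OF z] f[OF z] by (simp add: W_Cons m_assoc)
  qed (use j in auto)
  have VV: "star A V \<otimes> V = \<one>"
  proof -
    have "star A (?e (S j)) \<otimes> ?e (S j) = star A V \<otimes> (star A (S j) \<otimes> S j) \<otimes> V"
      unfolding eSj using j by (simp add: star_mult m_assoc)
    then show ?thesis using iso[OF j] star_S_S[OF j j] by simp
  qed
  have starV: "star A V \<otimes> S (f z) = S z" if z: "z \<in> {1..n}" for z
  proof -
    have "star A V \<otimes> S (f z) = (star A V \<otimes> V) \<otimes> S z" using z VS[OF z] by (simp add: m_assoc)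
    then show ?thesis using VV z by simp
  qed
  \<comment> \<open>Compressing v gives S_j^* lambda_u(S_j) v = V v. Compressing V v gives S_j^* V
    S_j V v, which is V v again because V S_j = S_j.\<close>
  have "compress j v = V \<otimes> v"
    using j by (simp add: compress_def m_assoc vj V_def)
  moreover have "compress j (V \<otimes> v) = V \<otimes> v"
  proof -
    have "compress j (V \<otimes> v) = star A (S j) \<otimes> (V \<otimes> S j) \<otimes> V \<otimes> v"
      using j vj by (simp add: compress_def m_assoc eSj)
    then show ?thesis using VS[OF j] fj star_S_S[OF j j] j by simp
  qed
  ultimately have comp: "(compress j ^^ Suc M) v = V \<otimes> v" for M
    by (induction M) simp_all
  obtain M c a b where ab: "a \<in> carrier A" "b \<in> carrier A" and
    "nrm A ((compress j ^^ Suc M) v \<ominus> (c \<odot> \<one> \<oplus> S j \<otimes> a \<oplus> b \<otimes> star A (S j))) < e"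
    by (rule compress_approx[OF j v_closed e])
  then have less: "nrm A (V \<otimes> v \<ominus> (c \<odot> \<one> \<oplus> S j \<otimes> a \<oplus> b \<otimes> star A (S j))) < e" (is "nrm A ?d < e")
    unfolding comp by simp
  \<comment> \<open>Multiplying by \<open>?L\<close> on the left and S_x on the right recovers v
    from V v and turns 1 into lambda_u(S_x)^* S_y, since V^* S_x = S_y. The term with S_j a vanishes
    by \<open>kill\<close>, the term with b S_j^* because x differs from j.\<close>
  let ?L = "star A (?e (S x)) \<otimes> star A V"
  have L: "?L \<in> carrier A" using x by simp
  have kill: "star A (?e (S x)) \<otimes> S j = \<zero>"
  proof -
    have "star A (S j) \<otimes> ?e (S x) = \<zero>"
    proof (rule cuntz_family_eqI[OF family])
      fix z assume z: "z \<in> {1..n}"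
      obtain p q where pq: "p \<in> {1..n}" "q \<in> {1..n}" "u [x, z] = [p, q]"
        using uw[OF x z] words_2 by auto
      have "star A (S j) \<otimes> ?e (S x) \<otimes> S z = (star A (S j) \<otimes> S p) \<otimes> S q"
        using x z j pq perm_endo_S_S[OF u x z] by (simp add: m_assoc W_Cons)
      also have "\<dots> = \<zero> \<otimes> S z" using off[OF z] pq j z star_S_S[OF j pq(1)] by simp
      finally show "star A (S j) \<otimes> ?e (S x) \<otimes> S z = \<zero> \<otimes> S z" .
    qed (use j x in auto)
    then have "star A (star A (S j) \<otimes> ?e (S x)) = \<zero>" by simp
    then show ?thesis using j x by (simp add: star_mult star_star)
  qed
  have "?L \<otimes> ?d \<otimes> S x = v \<ominus> c \<odot> (star A (?e (S x)) \<otimes> S y)"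
  proof -
    have "?L \<otimes> ?d \<otimes> S x = star A (?e (S x)) \<otimes> (star A V \<otimes> V) \<otimes> (v \<otimes> S x)
        \<oplus> ((-1) * c) \<odot> (star A (?e (S x)) \<otimes> (star A V \<otimes> S x))
        \<oplus> (-1) \<odot> (star A (?e (S x)) \<otimes> (star A V \<otimes> S j) \<otimes> (a \<otimes> S x))
        \<oplus> (-1) \<odot> (?L \<otimes> b \<otimes> (star A (S j) \<otimes> S x))"
      using ab x j by (simp add: minus_eq_smult l_distr r_distr smult_add_right smult_smult
          smult_mult_left smult_mult_right m_assoc a_assoc)
    also have "star A (?e (S x)) \<otimes> (star A V \<otimes> V) \<otimes> (v \<otimes> S x) = v"
      using vx x VV iso[OF x] by (simp flip: m_assoc)
    also have "star A V \<otimes> S x = S y" using starV[OF y] fy by simp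
    also have "star A (?e (S x)) \<otimes> (star A V \<otimes> S j) \<otimes> (a \<otimes> S x) = \<zero>"
      using starV[OF j] fj kill ab x by simp
    also have "?L \<otimes> b \<otimes> (star A (S j) \<otimes> S x) = \<zero>"
      using star_S_S[OF j x] xj ab x by simp
    finally show ?thesis using x y by (simp add: minus_eq_smult smult_smult)
  qed
  moreover have "nrm A (?L \<otimes> ?d \<otimes> S x) \<le> nrm A ?d"
  proof -
    have d: "?d \<in> carrier A" using ab j by simp
    have "nrm A ?L \<le> 1"
      using x nrm_isometry[OF ec iso] nrm_isometry[OF V VV] by (intro nrm_mult_le_1) auto
    then have "nrm A (?L \<otimes> ?d) \<le> nrm A ?d" using L d by (intro nrm_contract_left) auto
    moreover have "nrm A (?L \<otimes> ?d \<otimes> S x) \<le> nrm A (?L \<otimes> ?d)"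
      using x L d nrm_S[OF j x] by (intro nrm_contract_right) auto
    ultimately show ?thesis by simp
  qed
  ultimately show thesis using less that[of c] by simp
qed

text \<open>The product of S_z^* v with its adjoint is 1, so S_z^* v is not zero and its norm is
  bounded away from zero.\<close>

lemma not_small:
  assumes z: "z \<in> {1..n}"
  shows "\<exists>e>0. \<not> nrm A (star A (S z) \<otimes> v) \<le> e"
proof (rule ccontr)
  assume "\<not> ?thesis"
  then have "star A (S z) \<otimes> v = \<zero>"
    using z v_closed by (intro eq_if_close) (auto simp: minus_eq_smult)
  then have "star A (S z) \<otimes> (v \<otimes> star A v) \<otimes> S z = \<zero>"
    using z v_closed by (simp flip: m_assoc)
  then show False using z v_star star_S_S[OF z z] one_not_zero by simp
qed

text \<open>S_z^* v is almost a multiple of the adjoint of \<open>W (u [x, z])\<close> times S_y,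
  and this vanishes unless \<open>u [x, z]\<close> begins with y. For
  \<open>u [x, y] = [y, m]\<close>, S_y^* v is almost a multiple of S_m^*; feeding this into S_y^* v
  = S_m^* (S_y^* v) S_x gives zero if m differs from x. Both outcomes contradict
  \<open>not_small\<close>.\<close>

theorem intertwiner_rigid:
  shows intertwiner_rigid_fst: "z \<in> {1..n} \<Longrightarrow> hd (u [x, z]) = y"
    and intertwiner_rigid_swap: "u [x, y] = [y, x]"
proof -
  let ?e = "perm_endo n A S 2 u"
  note [simp] = v_closed
  have ec [simp]: "i \<in> {1..n} \<Longrightarrow> ?e (S i) \<in> carrier A" for i
    using perm_endo_closed[OF u] by simp
  have approx: "\<exists>c. nrm A (star A (S z) \<otimes> v \<ominus> c \<odot> (star A (W (u [x, z])) \<otimes> S y)) < e"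
    if z: "z \<in> {1..n}" and "e > 0" for z e
  proof -
    obtain c where c: "nrm A (v \<ominus> c \<odot> (star A (?e (S x)) \<otimes> S y)) < e"
      by (rule intertwiner_approx[OF \<open>e > 0\<close>])
    let ?d = "v \<ominus> c \<odot> (star A (?e (S x)) \<otimes> S y)"
    have "star A (S z) \<otimes> ?d = star A (S z) \<otimes> v \<ominus> c \<odot> (star A (?e (S x) \<otimes> S z) \<otimes> S y)"
      using x y z by (simp add: minus_eq_smult r_distr smult_mult_right star_mult m_assoc)
    moreover have "nrm A (star A (S z) \<otimes> ?d) \<le> nrm A ?d"
      using x y z nrm_S[OF j z] by (intro nrm_contract_left) auto
    ultimately show ?thesis using c perm_endo_S_S[OF u x z] by (intro exI[of _ c]) simp
  qed
  have fst: "\<exists>q\<in>{1..n}. u [x, z] = [y, q]" if z: "z \<in> {1..n}" for z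
  proof (rule ccontr)
    assume neq: "\<not> ?thesis"
    have "u [x, z] \<in> words n 2"
      using x z permutes_words[OF u, of "[x, z]"] words_2 by auto
    then obtain p q where pq: "p \<in> {1..n}" "q \<in> {1..n}" "u [x, z] = [p, q]"
      using words_2 by auto
    have "p \<noteq> y" using pq neq by auto
    then have "star A (W (u [x, z])) \<otimes> S y = \<zero>"
      using pq y star_S_S[OF pq(1) y] by (simp add: W_Cons star_mult m_assoc)
    then have "nrm A (star A (S z) \<otimes> v) \<le> e" if "e > 0" for e
      using approx[OF z that] z by (simp add: minus_eq_smult)
    then show False using not_small[OF z] by blast
  qed
  show "z \<in> {1..n} \<Longrightarrow> hd (u [x, z]) = y" using fst by fastforce
  obtain m where m: "m \<in> {1..n}" "u [x, y] = [y, m]" using fst[OF y] by blast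
  show "u [x, y] = [y, x]"
  proof (rule ccontr)
    assume "u [x, y] \<noteq> [y, x]"
    then have mx: "m \<noteq> x" using m by auto
    have "star A (W (u [x, y])) \<otimes> S y = star A (S m)"
      using m y star_S_S[OF y y] by (simp add: W_Cons star_mult m_assoc)
    then have close: "\<exists>c. nrm A (star A (S y) \<otimes> v \<ominus> c \<odot> star A (S m)) < e" if "e > 0" for e
      using approx[OF y that] by simp
    have "nrm A (star A (S y) \<otimes> v) \<le> e" if e: "e > 0" for e
    proof -
      obtain c where c: "nrm A (star A (S y) \<otimes> v \<ominus> c \<odot> star A (S m)) < e"
        using close[OF e] by blast
      let ?d = "star A (S y) \<otimes> v \<ominus> c \<odot> star A (S m)"
      \<comment> \<open>Inserting lambda_u(S_x)^* lambda_u(S_x) = 1 makes the intertwining relation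
        for x applicable.\<close>
      have "star A (S y) \<otimes> v = star A (S y) \<otimes> (star A (?e (S x)) \<otimes> ?e (S x)) \<otimes> v"
        using y cuntz_family_isometry[OF perm_endo_family[OF u] x] by simp
      also have "\<dots> = star A (?e (S x) \<otimes> S y) \<otimes> (v \<otimes> S x)"
        using x y by (simp add: vx star_mult m_assoc)
      also have "\<dots> = star A (S m) \<otimes> (star A (S y) \<otimes> v) \<otimes> S x"
        using x y m perm_endo_S_S[OF u x y] by (simp add: W_Cons star_mult m_assoc)
      also have "\<dots> = star A (S m) \<otimes> ?d \<otimes> S x"
      proof -
        have "star A (S m) \<otimes> ?d \<otimes> S x = star A (S m) \<otimes> (star A (S y) \<otimes> v) \<otimes> S x
            \<oplus> (-c) \<odot> (star A (S m) \<otimes> (star A (S m) \<otimes> S x))"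
          using x y m by (simp add: minus_eq_smult l_distr r_distr smult_mult_left
              smult_mult_right smult_smult m_assoc)
        then show ?thesis using star_S_S[OF m(1) x] mx m x y by simp
      qed
      finally have "nrm A (star A (S y) \<otimes> v) = nrm A (star A (S m) \<otimes> ?d \<otimes> S x)" by simp
      also have "\<dots> \<le> nrm A (star A (S m) \<otimes> ?d)"
        using x y m nrm_S[OF j x] by (intro nrm_contract_right) auto
      also have "\<dots> \<le> nrm A ?d"
        using y m nrm_S[OF j m(1)] by (intro nrm_contract_left) auto
      finally show ?thesis using c by simp
    qed
    then show False using not_small[OF y] by blast
  qed
qed

end

end

section \<open>Permutations preserving a row and a column\<close>

locale index_triple =
  fixes i b1 b2 b3 :: nat
  assumes i: "i \<in> {1..4}" and distinct: "b1 \<noteq> b2" "b1 \<noteq> b3" "b2 \<noteq> b3"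
    and cover: "{b1, b2, b3} = {1..4} - {i}"
begin

lemma not_i [simp]: "b1 \<noteq> i" "b2 \<noteq> i" "b3 \<noteq> i" "i \<noteq> b1" "i \<noteq> b2" "i \<noteq> b3"
  using cover by auto

lemma index_iff: "x \<in> {1..4} \<longleftrightarrow> x = i \<or> x = b1 \<or> x = b2 \<or> x = b3"
proof -
  have "{1..4} = insert i {b1, b2, b3}" using cover i by blast
  then show ?thesis by (simp only: insert_iff empty_iff simp_thms)
qed

definition rot :: "nat \<Rightarrow> nat"
  where "rot x = (if x = b1 then b2 else if x = b2 then b3 else if x = b3 then b1 else x)"

definition flip :: "nat \<Rightarrow> nat"
  where "flip x = (if x = b1 then b3 else if x = b3 then b1 else x)"

text \<open>Integer exponents reduced modulo 3 let inverses be written with a minus sign and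
  postpone all reductions.\<close>

definition rot_pow :: "int \<Rightarrow> nat \<Rightarrow> nat"
  where "rot_pow p = rot ^^ nat (p mod 3)"

definition flip_pow :: "int \<Rightarrow> nat \<Rightarrow> nat"
  where "flip_pow s = (if even s then id else flip)"

lemmas [simp] = distinct distinct[symmetric]

lemma rot_cube: "rot (rot (rot x)) = x"
  by (simp add: rot_def)

lemma mod3_cases:
  fixes p :: int
  obtains "p mod 3 = 0" | "p mod 3 = 1" | "p mod 3 = 2"
  using pos_mod_bound[of 3 p] pos_mod_sign[of 3 p] by linarith

lemma rot_pow_0 [simp]: "rot_pow 0 = id" and rot_pow_1: "rot_pow 1 = rot"
  by (simp_all add: rot_pow_def)

lemma rot_pow_mod [simp]: "rot_pow (p mod 3) = rot_pow p"
  by (simp add: rot_pow_def)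

lemma rot_funpow_mod: "rot ^^ (k mod 3) = rot ^^ k"
proof (induction k rule: less_induct)
  case (less k)
  show ?case
  proof (cases "k < 3")
    case False
    then have k: "k = (k - 3) + 3" by simp
    then have "rot ^^ k = rot ^^ (k - 3) \<circ> (rot ^^ 3)" by (metis funpow_add)
    also have "rot ^^ 3 = id" by (rule ext) (simp add: numeral_3_eq_3 rot_cube)
    finally have "rot ^^ k = rot ^^ (k - 3)" by simp
    moreover have "(k - 3) mod 3 = k mod 3" using False by (metis k mod_add_self2)
    ultimately show ?thesis using less.IH[of "k - 3"] False by simp
  qed simp
qed

lemma rot_pow_add: "rot_pow (p + q) = rot_pow p \<circ> rot_pow q"
proof -
  have eq: "nat ((p + q) mod 3) = (nat (p mod 3) + nat (q mod 3)) mod 3"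
  proof -
    have "(p + q) mod 3 = (p mod 3 + q mod 3) mod 3" by (simp add: mod_add_eq)
    then show ?thesis by (cases p rule: mod3_cases; cases q rule: mod3_cases; simp)
  qed
  show ?thesis by (simp only: rot_pow_def eq rot_funpow_mod funpow_add)
qed

lemma rot_pow_cases:
  "rot_pow p = (if p mod 3 = 0 then id else if p mod 3 = 1 then rot else rot \<circ> rot)"
  by (rule mod3_cases[of p]) (simp_all add: rot_pow_def numeral_2_eq_2)

text \<open>A reflection of three points inverts rotations; this relation is the source of the
  action by inversion on Z_3^3.\<close>

lemma flip_rot_pow: "flip (rot_pow p x) = rot_pow (- p) (flip x)"
proof -
  have "(- p) mod 3 = (if p mod 3 = 0 then 0 else 3 - p mod 3)" by presburger
  then show ?thesis
    by (rule_tac mod3_cases[of p]) (auto simp: rot_pow_cases rot_def flip_def)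
qed

lemma flip_flip [simp]: "flip (flip x) = x"
  by (simp add: flip_def)

lemma flip_pow_add: "flip_pow (s + s') = flip_pow s \<circ> flip_pow s'"
  by (auto simp: flip_pow_def fun_eq_iff)

lemma flip_pow_rot_pow:
  "flip_pow s (rot_pow p x) = rot_pow (if even s then p else - p) (flip_pow s x)"
  by (simp add: flip_pow_def flip_rot_pow)

definition fixes_index :: "(nat \<Rightarrow> nat) \<Rightarrow> bool"
  where "fixes_index f \<longleftrightarrow> f permutes {1..4} \<and> f i = i"

lemma fixes_index_comp: "\<lbrakk>fixes_index f; fixes_index g\<rbrakk> \<Longrightarrow> fixes_index (f \<circ> g)"
  by (auto simp: fixes_index_def permutes_compose)

lemma fixes_index_id: "fixes_index id"
  by (simp add: fixes_index_def permutes_id)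

lemma fixes_indexI:
  assumes "inj f" "\<And>x. x \<notin> {b1, b2, b3} \<Longrightarrow> f x = x"
    "f b1 \<in> {b1, b2, b3}" "f b2 \<in> {b1, b2, b3}" "f b3 \<in> {b1, b2, b3}"
  shows "fixes_index f"
proof -
  have "f permutes {b1, b2, b3}"
    using assms by (intro inj_imp_permutes inj_on_subset[OF assms(1)]) auto
  then have "f permutes {1..4}" by (rule permutes_subset) (use cover in blast)
  then show ?thesis using assms(2)[of i] by (simp add: fixes_index_def)
qed

lemma fixes_index_rot: "fixes_index rot"
  by (rule fixes_indexI[OF inj_on_inverseI[of _ "rot \<circ> rot"]]) (auto simp: rot_cube, auto simp: rot_def)

lemma fixes_index_flip: "fixes_index flip"
  by (rule fixes_indexI[OF inj_on_inverseI[of _ flip]]) (simp, auto simp: flip_def)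

lemma fixes_index_rot_pow [simp]: "fixes_index (rot_pow p)"
  by (simp add: rot_pow_cases fixes_index_id fixes_index_rot fixes_index_comp)

lemma fixes_index_flip_pow [simp]: "fixes_index (flip_pow s)"
  by (simp add: flip_pow_def fixes_index_id fixes_index_flip)

lemma fixes_index_iff: "fixes_index f \<Longrightarrow> f x = i \<longleftrightarrow> x = i"
  unfolding fixes_index_def by (metis permutes_inj injD)

lemma fixes_index_range: "fixes_index f \<Longrightarrow> f x \<in> {1..4} \<longleftrightarrow> x \<in> {1..4}"
  unfolding fixes_index_def by (metis permutes_in_image)

section \<open>Permutations of two-letter words in block form\<close>

text \<open>If all four maps fix i, row i and column i are preserved, and the complementary 3 by 3
  block is permuted by the tensor product of k and h.\<close>

definition block :: "(nat \<Rightarrow> nat) \<Rightarrow> (nat \<Rightarrow> nat) \<Rightarrow> (nat \<Rightarrow> nat) \<Rightarrow> (nat \<Rightarrow> nat) \<Rightarrow> nat list \<Rightarrow> nat list"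
  where "block f g h k \<alpha> = (if \<alpha> \<in> words 4 2 then
      let x = hd \<alpha>; y = hd (tl \<alpha>) in
        if x = i then [i, f y] else if y = i then [g x, i] else [k x, h y]
    else \<alpha>)"

lemma block_simps:
  assumes "x \<in> {1..4}" "y \<in> {1..4}"
  shows "block f g h k [x, y] =
    (if x = i then [i, f y] else if y = i then [g x, i] else [k x, h y])"
  using assms by (simp add: block_def words_def)

lemma block_permutes:
  assumes "fixes_index f" "fixes_index g" "fixes_index h" "fixes_index k"
  shows "block f g h k permutes words 4 2"
proof -
  have into: "block f g h k \<alpha> \<in> words 4 2" if \<alpha>: "\<alpha> \<in> words 4 2" for \<alpha>
  proof -
    obtain x y where xy: "x \<in> {1..4}" "y \<in> {1..4}" "\<alpha> = [x, y]" using iffD1[OF words_2 \<alpha>] by blast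
    have "[p, q] \<in> words 4 2" if "p \<in> {1..4}" "q \<in> {1..4}" for p q
      using that by (simp add: words_def)
    then show ?thesis
      unfolding xy(3) block_simps[OF xy(1,2)]
      using xy(1,2) i assms[THEN fixes_index_range] by simp
  qed
  have "inj_on (block f g h k) (words 4 2)"
  proof (rule inj_onI)
    fix \<alpha> \<beta> assume ab: "\<alpha> \<in> words 4 2" "\<beta> \<in> words 4 2" and eq: "block f g h k \<alpha> = block f g h k \<beta>"
    obtain x y where a: "x \<in> {1..4}" "y \<in> {1..4}" "\<alpha> = [x, y]" using iffD1[OF words_2 ab(1)] by blast
    obtain x' y' where b: "x' \<in> {1..4}" "y' \<in> {1..4}" "\<beta> = [x', y']" using iffD1[OF words_2 ab(2)] by blast
    have inj: "f z = f z' \<longleftrightarrow> z = z'" "g z = g z' \<longleftrightarrow> z = z'" "h z = h z' \<longleftrightarrow> z = z'"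
      "k z = k z' \<longleftrightarrow> z = z'" for z z'
      using assms unfolding fixes_index_def by (metis permutes_inj injD)+
    show "\<alpha> = \<beta>"
      using eq assms unfolding a(3) b(3) block_simps[OF a(1,2)] block_simps[OF b(1,2)]
      by (auto simp: inj fixes_index_iff eq_commute[of i] split: if_splits)
  qed
  then show ?thesis
    by (rule inj_imp_permutes[OF _ finite_words into]) (simp_all add: block_def)
qed

text \<open>The equations come from comparing words of length three, sorted by which letters equal
  i. F and H are met only at values of g and k because \<open>on_last\<close> has already changed a
  second letter other than i, by g if the third letter is i and by k otherwise.\<close>

lemma block_compose:
  assumes u: "fixes_index f" "fixes_index g" "fixes_index h" "fixes_index k"
    and v: "fixes_index f'" "fixes_index g'" "fixes_index h'" "fixes_index k'"
    and w: "fixes_index F" "fixes_index G" "fixes_index H" "fixes_index K"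
    and eq: "\<And>x. F (g x) = f (g (f' x))" "\<And>x. F (k x) = f (k (f' x))"
      "\<And>x. H (g x) = h (g (h' x))" "\<And>x. H (k x) = h (k (h' x))"
      "\<And>x. G x = g (g' x)" "\<And>x. K x = k (k' x)"
    and \<gamma>: "\<gamma> \<in> words 4 3"
  shows "on_first (block F G H K) (on_last (block f g h k) \<gamma>)
    = on_first (block f g h k) (on_last (block f g h k)
        (on_first (block f' g' h' k') \<gamma>))"
proof -
  obtain x y z where xyz: "x \<in> {1..4}" "y \<in> {1..4}" "z \<in> {1..4}" "\<gamma> = [x, y, z]"
    using \<gamma> by (auto simp: words_def length_Suc_conv numeral_3_eq_3)
  have i': "i \<in> {1..4}" by (rule i)
  have fi: "f i = i" "F i = i" "f' i = i" using u v w by (auto simp: fixes_index_def)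
  note rg = u[THEN fixes_index_range] v[THEN fixes_index_range] w[THEN fixes_index_range]
  note ii = u[THEN fixes_index_iff] v[THEN fixes_index_iff] w[THEN fixes_index_iff]
  show ?thesis
    unfolding xyz(4) on_first_def on_last_def
    using xyz(1-3) i'
    by (cases "x = i"; cases "y = i"; cases "z = i")
      (simp_all add: block_simps rg ii fi eq del: atLeastAtMost_iff One_nat_def)
qed

lemma rot_pow_rot_pow: "rot_pow p (rot_pow q x) = rot_pow (p + q) x"
  by (simp add: rot_pow_add)

lemma flip_pow_flip_pow: "flip_pow s (flip_pow s' x) = flip_pow (s + s') x"
  by (simp add: flip_pow_add)

section \<open>The 54 permutations and their composition law\<close>

definition twist :: "int \<Rightarrow> int \<Rightarrow> int"
  where "twist s p = (if even s then p else - p)"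

text \<open>On two-letter words this is the normal form a^p b^q c^r (t \<otimes> 1)^s in the
  generating permutations.\<close>

definition sym :: "int \<Rightarrow> int \<Rightarrow> int \<Rightarrow> int \<Rightarrow> nat list \<Rightarrow> nat list"
  where "sym p q r s = block (rot_pow p) (rot_pow q \<circ> flip_pow s) (rot_pow r) (flip_pow s)"

lemma sym_permutes: "sym p q r s permutes words 4 2"
  unfolding sym_def by (intro block_permutes fixes_index_comp) simp_all

text \<open>Moving a flip past a rotation reverses the rotation, hence the signs
  \<open>twist s\<close> on the exponents of the second permutation.\<close>

lemma sym_compose:
  assumes "\<gamma> \<in> words 4 3"
  shows "on_first (sym (p + twist s p') (q + twist s q') (r + twist s r') (s + s')) (on_last (sym p q r s) \<gamma>)
    = on_first (sym p q r s) (on_last (sym p q r s) (on_first (sym p' q' r' s') \<gamma>))"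
  unfolding sym_def
  by (rule block_compose[OF _ _ _ _ _ _ _ _ _ _ _ _ _ _ _ _ _ _ assms])
    (simp_all add: fixes_index_comp flip_pow_rot_pow rot_pow_rot_pow flip_pow_flip_pow twist_def
      add.assoc add.commute add.left_commute)

lemma sym_mod: "sym (p mod 3) (q mod 3) (r mod 3) (s mod 2) = sym p q r s"
  by (simp add: sym_def flip_pow_def)

lemma sym_0: "sym 0 0 0 0 = id"
proof
  fix \<alpha>
  show "sym 0 0 0 0 \<alpha> = id \<alpha>"
  proof (cases "\<alpha> \<in> words 4 2")
    case True
    obtain x y where xy: "x \<in> {1..4}" "y \<in> {1..4}" "\<alpha> = [x, y]"
      using iffD1[OF words_2 True] by blast
    show ?thesis unfolding xy(3) sym_def block_simps[OF xy(1,2)] by (simp add: flip_pow_def)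
  qed (simp add: sym_def block_def)
qed

lemma rot_pow_fixed:
  assumes "x \<in> {b1, b2, b3}" "rot_pow p x = x"
  shows "3 dvd p"
proof -
  have "p mod 3 = 0"
    by (rule mod3_cases[of p]) (use assms in \<open>auto simp: rot_pow_cases rot_def\<close>)
  then show ?thesis by presburger
qed

text \<open>For odd s, \<open>rot_pow p\<close> after the flip would be a reflection of three
  points, which has a single fixed point, while two are given. For even s, a rotation with a fixed
  point is trivial.\<close>

lemma sym_parameters_zero:
  assumes x: "x \<in> {b1, b2, b3}" and x': "x' \<in> {b1, b2, b3}" and neq: "x \<noteq> x'"
    and rigid: "\<And>z. z \<in> {x, x'} \<Longrightarrow> rot_pow p (flip_pow s z) = z
      \<and> rot_pow q (flip_pow s z) = flip_pow s z \<and> rot_pow r (flip_pow s z) = z"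
  shows "3 dvd p \<and> 3 dvd q \<and> 3 dvd r \<and> even s"
proof -
  have s: "even s"
  proof (rule ccontr)
    assume "odd s"
    then have "rot_pow p (flip x) = x" "rot_pow p (flip x') = x'"
      using rigid by (auto simp: flip_pow_def)
    then show False using x x' neq
      by (rule_tac mod3_cases[of p]) (auto simp: rot_pow_cases rot_def flip_def split: if_splits)
  qed
  then show ?thesis using rigid[of x] rot_pow_fixed[OF x] by (simp add: flip_pow_def)
qed

lemma words_index_cases:
  assumes "\<alpha> \<in> words 4 2"
  obtains x y where "\<alpha> = [x, y]" "x = i \<or> x = b1 \<or> x = b2 \<or> x = b3" "y = i \<or> y = b1 \<or> y = b2 \<or> y = b3"
  using iffD1[OF words_2 assms] index_iff by blast

lemma in_index [simp]: "b1 \<in> {1..4}" "b2 \<in> {1..4}" "b3 \<in> {1..4}" "i \<in> {1..4}"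
  using index_iff by blast+

lemma generators_eq_sym:
  assumes "\<alpha> \<in> words 4 2"
  shows "perm_a i (b1, b2, b3) \<alpha> = sym 1 0 0 0 \<alpha>"
    and "perm_b i (b1, b2, b3) \<alpha> = sym 0 1 0 0 \<alpha>"
    and "perm_c (b1, b2, b3) \<alpha> = sym 0 0 1 0 \<alpha>"
    and "perm_tensor 4 1 1 (perm_t (b1, b2, b3)) id \<alpha> = sym 0 0 0 1 \<alpha>"
proof -
  obtain x y where \<alpha>: "\<alpha> = [x, y]" and x: "x = i \<or> x = b1 \<or> x = b2 \<or> x = b3"
    and y: "y = i \<or> y = b1 \<or> y = b2 \<or> y = b3"
    by (rule words_index_cases[OF assms])
  have b: "block f g h k [x, y] =
    (if x = i then [i, f y] else if y = i then [g x, i] else [k x, h y])" for f g h k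
    by (rule block_simps) (use x y index_iff in blast)+
  show "perm_a i (b1, b2, b3) \<alpha> = sym 1 0 0 0 \<alpha>"
    using x y unfolding \<alpha> sym_def b
    by (elim disjE) (simp_all add: perm_a_def row_cycle_def rot_pow_1 flip_pow_def rot_def transpose_def)
  show "perm_b i (b1, b2, b3) \<alpha> = sym 0 1 0 0 \<alpha>"
    using x y unfolding \<alpha> sym_def b
    by (elim disjE) (simp_all add: perm_b_def rot_pow_1 flip_pow_def rot_def transpose_def)
  show "perm_c (b1, b2, b3) \<alpha> = sym 0 0 1 0 \<alpha>"
    using x y unfolding \<alpha> sym_def b
    by (elim disjE) (simp_all add: perm_c_def row_cycle_def rot_pow_1 flip_pow_def rot_def transpose_def)
  show "perm_tensor 4 1 1 (perm_t (b1, b2, b3)) id \<alpha> = sym 0 0 0 1 \<alpha>"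
    using x y assms unfolding \<alpha> sym_def b
    by (elim disjE) (simp_all add: perm_tensor_def words_def perm_t_def flip_pow_def flip_def transpose_def)
qed

end

section \<open>Automorphisms modulo inner automorphisms\<close>

text \<open>The explicit map goes from the semidirect product to the group L_i and is inverted here.
  Closure of H under multiplication suffices, which spares a separate proof that the semidirect
  product is a group.\<close>

lemma is_iso_if_inverse_hom:
  assumes bij: "bij_betw h (carrier H) (carrier G)"
    and closed: "\<And>x y. \<lbrakk>x \<in> carrier H; y \<in> carrier H\<rbrakk> \<Longrightarrow> x \<otimes>\<^bsub>H\<^esub> y \<in> carrier H"
    and mult: "\<And>x y. \<lbrakk>x \<in> carrier H; y \<in> carrier H\<rbrakk> \<Longrightarrow> h (x \<otimes>\<^bsub>H\<^esub> y) = h x \<otimes>\<^bsub>G\<^esub> h y"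
  shows "G \<cong> H"
proof -
  let ?g = "inv_into (carrier H) h"
  have bij': "bij_betw ?g (carrier G) (carrier H)" by (rule bij_betw_inv_into[OF bij])
  have "?g (a \<otimes>\<^bsub>G\<^esub> b) = ?g a \<otimes>\<^bsub>H\<^esub> ?g b" if "a \<in> carrier G" "b \<in> carrier G" for a b
  proof -
    have g: "?g a \<in> carrier H" "?g b \<in> carrier H" using bij' that by (auto simp: bij_betw_def)
    then have "h (?g a \<otimes>\<^bsub>H\<^esub> ?g b) = a \<otimes>\<^bsub>G\<^esub> b"
      using mult bij that by (simp add: bij_betw_inv_into_right)
    then show ?thesis using bij closed[OF g] bij_betw_inv_into_left by metis
  qed
  then have "?g \<in> iso G H"
    using bij' by (auto simp: iso_def hom_def bij_betw_def)
  then show ?thesis by (auto simp: is_iso_def)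
qed

context cstar_algebra
begin

lemma carrier_cstar_Aut: "carrier (cstar_Aut A) = star_hom A A \<inter> Bij (carrier A)"
  by (simp add: cstar_Aut_def)

lemma one_cstar_Aut: "\<one>\<^bsub>cstar_Aut A\<^esub> = (\<lambda>x\<in>carrier A. x)"
  by (simp add: cstar_Aut_def BijGroup_def)

lemma mult_cstar_Aut:
  "\<lbrakk>\<phi> \<in> Bij (carrier A); \<psi> \<in> Bij (carrier A)\<rbrakk> \<Longrightarrow> \<phi> \<otimes>\<^bsub>cstar_Aut A\<^esub> \<psi> = compose (carrier A) \<phi> \<psi>"
  by (simp add: cstar_Aut_def BijGroup_def)

lemma monoid_cstar_Aut: "monoid (cstar_Aut A)"
proof -
  interpret BG: group "BijGroup (carrier A)" by (rule group_BijGroup)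
  have "submonoid (star_hom A A \<inter> Bij (carrier A)) (BijGroup (carrier A))"
    by (rule submonoid.intro)
      (auto simp: BijGroup_def identity_star_hom id_Bij compose_Bij star_hom_compose)
  then show ?thesis unfolding cstar_Aut_def
    by (rule submonoid.submonoid_is_monoid) (rule BG.monoid_axioms)
qed

lemma BijI_inverse:
  assumes "\<phi> \<in> extensional (carrier A)"
    and "\<And>x. x \<in> carrier A \<Longrightarrow> \<phi> x \<in> carrier A" "\<And>x. x \<in> carrier A \<Longrightarrow> \<psi> x \<in> carrier A"
    and "\<And>x. x \<in> carrier A \<Longrightarrow> \<psi> (\<phi> x) = x" "\<And>x. x \<in> carrier A \<Longrightarrow> \<phi> (\<psi> x) = x"
  shows "\<phi> \<in> Bij (carrier A)"
proof -
  have "bij_betw \<phi> (carrier A) (carrier A)"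
    by (rule bij_betw_byWitness[where f' = \<psi>]) (use assms in auto)
  then show ?thesis using assms(1) by (simp add: Bij_def)
qed

lemma inner_cancel:
  assumes w: "w \<in> carrier A" "v \<in> carrier A" "v \<otimes> w = \<one>" and x: "x \<in> carrier A"
    and wv: "star A w = v"
  shows "v \<otimes> (w \<otimes> x \<otimes> star A w) \<otimes> star A v = x"
proof -
  have "v \<otimes> (w \<otimes> x \<otimes> star A w) \<otimes> star A v = (v \<otimes> w) \<otimes> x \<otimes> (v \<otimes> w)"
    using w(1,2) x wv star_star[of w] by (simp add: m_assoc)
  also have "\<dots> = x" unfolding w(3) using x by simp
  finally show ?thesis .
qed

lemma cstar_Inn_Bij:
  assumes "\<phi> \<in> cstar_Inn A" shows "\<phi> \<in> Bij (carrier A)"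
proof -
  obtain w where w: "w \<in> unitaries A" and \<phi>: "\<phi> = (\<lambda>x\<in>carrier A. w \<otimes> x \<otimes> star A w)"
    using assms by (auto simp: cstar_Inn_def)
  have w': "w \<in> carrier A" "star A w \<otimes> w = \<one>" "w \<otimes> star A w = \<one>" using w by (auto simp: unitaries_def)
  show ?thesis
  proof (rule BijI_inverse[of _ "\<lambda>x. star A w \<otimes> x \<otimes> star A (star A w)"])
    show "star A w \<otimes> \<phi> x \<otimes> star A (star A w) = x" if "x \<in> carrier A" for x
      using inner_cancel[OF w'(1) _ w'(2) that] w' that by (simp add: \<phi>)
    show "\<phi> (star A w \<otimes> x \<otimes> star A (star A w)) = x" if "x \<in> carrier A" for x
      using inner_cancel[OF _ w'(1) w'(3) that] w' that by (simp add: \<phi> star_star)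
  qed (use w' in \<open>auto simp: \<phi>\<close>)
qed

lemma one_in_cstar_Inn: "(\<lambda>x\<in>carrier A. x) \<in> cstar_Inn A"
proof -
  have "\<one> \<in> unitaries A" by (simp add: unitaries_def)
  moreover have "(\<lambda>x\<in>carrier A. x) = (\<lambda>x\<in>carrier A. \<one> \<otimes> x \<otimes> star A \<one>)" by (auto simp: restrict_def)
  ultimately show ?thesis unfolding cstar_Inn_def by blast
qed

lemma compose_identity_left:
  "\<phi> \<in> Bij (carrier A) \<Longrightarrow> compose (carrier A) (\<lambda>x\<in>carrier A. x) \<phi> = \<phi>"
  by (rule Id_compose) (auto simp: Bij_imp_funcset Bij_imp_extensional)

text \<open>The identity is inner, so the first automorphism lies in its own coset and hence in that
  of the second one; the unitary is read off from there.\<close>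

lemma out_projD:
  assumes "\<phi> \<in> Bij (carrier A)" "\<psi> \<in> Bij (carrier A)" "out_proj A \<phi> = out_proj A \<psi>"
  obtains w where "w \<in> unitaries A" "\<And>x. x \<in> carrier A \<Longrightarrow> \<phi> x = w \<otimes> \<psi> x \<otimes> star A w"
proof -
  have "\<phi> \<in> out_proj A \<phi>"
    unfolding out_proj_def r_coset_def
    using one_in_cstar_Inn assms(1) mult_cstar_Aut[OF id_Bij assms(1)] compose_identity_left by force
  then obtain \<iota> where \<iota>: "\<iota> \<in> cstar_Inn A" "\<phi> = \<iota> \<otimes>\<^bsub>cstar_Aut A\<^esub> \<psi>"
    unfolding assms(3) unfolding out_proj_def r_coset_def by auto
  obtain w where w: "w \<in> unitaries A" "\<iota> = (\<lambda>x\<in>carrier A. w \<otimes> x \<otimes> star A w)"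
    using \<iota>(1) by (auto simp: cstar_Inn_def)
  have "\<phi> x = w \<otimes> \<psi> x \<otimes> star A w" if "x \<in> carrier A" for x
    using \<iota>(2) mult_cstar_Aut[OF cstar_Inn_Bij[OF \<iota>(1)] assms(2)] that
      Bij_imp_funcset[OF assms(2)] w(2) by (auto simp: compose_def)
  with w(1) show thesis by (rule that)
qed

lemma out_proj_one: "out_proj A (\<lambda>x\<in>carrier A. x) = cstar_Inn A"
proof -
  have "compose (carrier A) \<iota> (\<lambda>x\<in>carrier A. x) = \<iota>" if "\<iota> \<in> cstar_Inn A" for \<iota>
    by (rule compose_Id[OF Bij_imp_funcset Bij_imp_extensional])
      (use cstar_Inn_Bij[OF that] in auto)
  then show ?thesis
    unfolding out_proj_def r_coset_def
    using cstar_Inn_Bij by (auto simp: mult_cstar_Aut id_Bij)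
qed

end

section \<open>The action of Z_2 on Z_3^3\<close>

text \<open>The restriction to the carrier is there because \<open>auto\<close> consists of
  extensional maps. Letting s range over all integers allows sums to be used before reduction modulo
  2.\<close>

definition twisting :: "int \<Rightarrow> int \<times> int \<times> int \<Rightarrow> int \<times> int \<times> int"
  where "twisting s = (\<lambda>(p, q, r)\<in>carrier Z3_cubed.
    if even s then (p, q, r) else (- p mod 3, - q mod 3, - r mod 3))"

lemma twisting_simp:
  "(p, q, r) \<in> carrier Z3_cubed \<Longrightarrow> twisting s (p, q, r) =
    (if even s then (p, q, r) else (- p mod 3, - q mod 3, - r mod 3))"
  by (simp add: twisting_def)

lemma twisting_closed: "x \<in> carrier Z3_cubed \<Longrightarrow> twisting s x \<in> carrier Z3_cubed"
  by (cases x) (auto simp: twisting_simp carrier_integer_mod_group)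

lemma twisting_twisting: "x \<in> carrier Z3_cubed \<Longrightarrow> twisting s (twisting t x) = twisting (s + t) x"
proof (cases x)
  case (fields p q r)
  assume "x \<in> carrier Z3_cubed"
  then have x: "(p, q, r) \<in> carrier Z3_cubed" and y: "(- p mod 3, - q mod 3, - r mod 3) \<in> carrier Z3_cubed"
    using fields by (auto simp: carrier_integer_mod_group)
  have neg: "- (- m mod 3) mod 3 = m" if "0 \<le> m" "m < 3" for m :: int
    using that by presburger
  show ?thesis using x unfolding fields
    by (simp add: twisting_simp[OF x] twisting_simp[OF y] neg carrier_integer_mod_group)
qed

lemma twisting_auto: "twisting s \<in> auto Z3_cubed"
proof -
  have "bij_betw (twisting s) (carrier Z3_cubed) (carrier Z3_cubed)"
  proof (rule bij_betw_byWitness[where f' = "twisting s"])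
    \<comment> \<open>\<open>s + s\<close> is even, so each of these maps is its own
      inverse.\<close>
    have "twisting (s + s) x = x" if "x \<in> carrier Z3_cubed" for x
      using that by (cases x) (simp add: twisting_simp)
    then show "\<forall>x\<in>carrier Z3_cubed. twisting s (twisting s x) = x"
      "\<forall>x\<in>carrier Z3_cubed. twisting s (twisting s x) = x"
      by (simp_all add: twisting_twisting)
  qed (rule image_subsetI, erule twisting_closed)+
  moreover have "twisting s \<in> extensional (carrier Z3_cubed)" by (simp add: twisting_def)
  moreover have "twisting s \<in> hom Z3_cubed Z3_cubed"
  proof (rule homI)
    fix x y assume xy: "x \<in> carrier Z3_cubed" "y \<in> carrier Z3_cubed"
    obtain p q r where x: "x = (p, q, r)" by (cases x)
    obtain p' q' r' where y: "y = (p', q', r')" by (cases y)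
    have "((p + p') mod 3, (q + q') mod 3, (r + r') mod 3) \<in> carrier Z3_cubed"
      by (simp add: carrier_integer_mod_group)
    then show "twisting s (x \<otimes>\<^bsub>Z3_cubed\<^esub> y) = twisting s x \<otimes>\<^bsub>Z3_cubed\<^esub> twisting s y"
      using xy unfolding x y by (simp add: twisting_simp DirProd_def mod_simps minus_diff_commute)
  qed (rule twisting_closed)
  ultimately show ?thesis by (simp add: auto_def Bij_def)
qed

lemma twisting_hom: "twisting \<in> hom (integer_mod_group 2) (AutoGroup Z3_cubed)"
proof (rule homI)
  fix s t :: int
  have "twisting ((s + t) mod 2) = compose (carrier Z3_cubed) (twisting s) (twisting t)"
  proof
    fix x
    have "twisting ((s + t) mod 2) = twisting (s + t)" by (simp add: twisting_def)
    then show "twisting ((s + t) mod 2) x = compose (carrier Z3_cubed) (twisting s) (twisting t) x"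
      by (cases "x \<in> carrier Z3_cubed")
        (auto simp: compose_def twisting_twisting, auto simp: twisting_def)
  qed
  moreover have "twisting k \<in> Bij (carrier Z3_cubed)" for k
    using twisting_auto[of k] by (simp add: auto_def)
  ultimately show "twisting (s \<otimes>\<^bsub>integer_mod_group 2\<^esub> t) = twisting s \<otimes>\<^bsub>AutoGroup Z3_cubed\<^esub> twisting t"
    by (simp add: AutoGroup_def BijGroup_def)
qed (simp add: AutoGroup_def twisting_auto)

section \<open>The groups \<open>L\<^sub>i\<close>\<close>

locale cuntz_triple = index_triple i b1 b2 b3 + cuntz_algebra 4 A S
  for i b1 b2 b3 :: nat and A :: "'a cstar" (structure) and S :: "nat \<Rightarrow> 'a"
begin

section \<open>Parametrisation of L_i by four exponents\<close>

abbreviation E :: "int \<Rightarrow> int \<Rightarrow> int \<Rightarrow> int \<Rightarrow> 'a \<Rightarrow> 'a"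
  where "E p q r s \<equiv> perm_endo 4 A S 2 (sym p q r s)"

lemma E_compose:
  "compose (carrier A) (E p q r s) (E p' q' r' s') =
    E (p + twist s p') (q + twist s q') (r + twist s r') (s + s')"
  by (rule perm_endo_compose[OF sym_permutes sym_permutes sym_permutes sym_compose])

lemma E_0: "E 0 0 0 0 = (\<lambda>x\<in>carrier A. x)"
  unfolding sym_0 by (rule perm_endo_id)

lemma E_inverse:
  "compose (carrier A) (E p q r s) (E (- twist s p) (- twist s q) (- twist s r) (- s)) = (\<lambda>x\<in>carrier A. x)"
  "compose (carrier A) (E (- twist s p) (- twist s q) (- twist s r) (- s)) (E p q r s) = (\<lambda>x\<in>carrier A. x)"
  unfolding E_compose by (simp_all add: twist_def E_0)

lemma E_Bij: "E p q r s \<in> Bij (carrier A)"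
proof (rule BijI_inverse[of _ "E (- twist s p) (- twist s q) (- twist s r) (- s)"])
  show "E p q r s \<in> extensional (carrier A)"
    by (rule star_hom_extensional[OF perm_endo_star_hom[OF sym_permutes]])
  fix x assume x: "x \<in> carrier A"
  show "E (- twist s p) (- twist s q) (- twist s r) (- s) (E p q r s x) = x"
    using fun_cong[OF E_inverse(2)[where p = p and q = q and r = r and s = s], of x] x by (simp add: compose_def)
  show "E p q r s (E (- twist s p) (- twist s q) (- twist s r) (- s) x) = x"
    using fun_cong[OF E_inverse(1)[where p = p and q = q and r = r and s = s], of x] x by (simp add: compose_def)
qed (simp_all add: perm_endo_closed[OF sym_permutes])

lemma E_Aut: "E p q r s \<in> carrier (cstar_Aut A)"
  by (simp add: carrier_cstar_Aut E_Bij perm_endo_star_hom[OF sym_permutes])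

lemma E_mult:
  "E p q r s \<otimes>\<^bsub>cstar_Aut A\<^esub> E p' q' r' s' =
    E (p + twist s p') (q + twist s q') (r + twist s r') (s + s')"
  by (simp add: mult_cstar_Aut E_Bij E_compose)

lemma E_inv:
  "inv\<^bsub>cstar_Aut A\<^esub> (E p q r s) = E (- twist s p) (- twist s q) (- twist s r) (- s)"
  by (rule monoid.inv_unique'[OF monoid_cstar_Aut, symmetric])
    (simp_all add: E_Aut mult_cstar_Aut E_Bij E_inverse one_cstar_Aut)

lemma perm_endo_cong:
  assumes "\<And>\<alpha>. \<alpha> \<in> words 4 2 \<Longrightarrow> u \<alpha> = sym p q r s \<alpha>"
  shows "perm_endo 4 A S 2 u = E p q r s"
proof -
  have "perm_unitary 4 A S 2 u = perm_unitary 4 A S 2 (sym p q r s)"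
    unfolding perm_unitary_def
    using assms W_words_closed W_words_closed[OF permutes_words[OF sym_permutes]]
    by (intro finsum_cong') auto
  then show ?thesis by (simp add: perm_endo_def)
qed

lemma L_group_generate:
  "L_group A S i (b1, b2, b3) = generate (cstar_Aut A) {E 1 0 0 0, E 0 1 0 0, E 0 0 1 0, E 0 0 0 1}"
  unfolding L_group_def
  by (simp only: perm_endo_cong[OF generators_eq_sym(1)] perm_endo_cong[OF generators_eq_sym(2)]
      perm_endo_cong[OF generators_eq_sym(3)] perm_endo_cong[OF generators_eq_sym(4)])

lemma L_group_eq: "L_group A S i (b1, b2, b3) = {E p q r s | p q r s. True}"
proof
  let ?G = "generate (cstar_Aut A) {E 1 0 0 0, E 0 1 0 0, E 0 0 1 0, E 0 0 0 1}"
  have "x \<in> ?G \<Longrightarrow> \<exists>p q r s. x = E p q r s" for x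
  proof (induction rule: generate.induct)
    case one
    show ?case unfolding one_cstar_Aut E_0[symmetric] by blast
  next
    case (incl h)
    then show ?case by blast
  next
    case (inv h)
    then show ?case by (elim insertE emptyE; simp only: E_inv; blast)
  next
    case (eng x y)
    then obtain p q r s p' q' r' s' where xy: "x = E p q r s" "y = E p' q' r' s'" by blast
    show ?case unfolding xy E_mult by blast
  qed
  then show "L_group A S i (b1, b2, b3) \<subseteq> {E p q r s | p q r s. True}"
    unfolding L_group_generate by blast
  \<comment> \<open>Nonnegative powers of the generators are enough, as exponents matter only modulo
    3 and modulo 2.\<close>
  have pow: "E (int k) 0 0 0 \<in> ?G \<and> E 0 (int k) 0 0 \<in> ?G \<and> E 0 0 (int k) 0 \<in> ?G \<and> E 0 0 0 (int k) \<in> ?G" for k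
  proof (induction k)
    case 0
    have "E 0 0 0 0 \<in> ?G" unfolding E_0 one_cstar_Aut[symmetric] by (rule generate.one)
    then show ?case by simp
  next
    case (Suc k)
    have step: "h \<in> ?G" if "h = g \<otimes>\<^bsub>cstar_Aut A\<^esub> g'" "g \<in> {E 1 0 0 0, E 0 1 0 0, E 0 0 1 0, E 0 0 0 1}" "g' \<in> ?G" for h g g'
      unfolding that(1) by (rule generate.eng[OF generate.incl[OF that(2)] that(3)])
    show ?case
      using Suc
      by (intro conjI; elim conjE)
        (rule step[of _ "E 1 0 0 0" "E (int k) 0 0 0"] step[of _ "E 0 1 0 0" "E 0 (int k) 0 0"]
            step[of _ "E 0 0 1 0" "E 0 0 (int k) 0"] step[of _ "E 0 0 0 1" "E 0 0 0 (int k)"];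
          simp add: E_mult twist_def)+
  qed
  have "E p q r s \<in> ?G" for p q r s
  proof -
    \<comment> \<open>With the flip in the last factor every \<open>twist\<close> is trivial, so the
      exponents simply collect.\<close>
    have "E (p mod 3) 0 0 0 \<otimes>\<^bsub>cstar_Aut A\<^esub> E 0 (q mod 3) 0 0 \<otimes>\<^bsub>cstar_Aut A\<^esub> E 0 0 (r mod 3) 0
        \<otimes>\<^bsub>cstar_Aut A\<^esub> E 0 0 0 (s mod 2) \<in> ?G"
      using pow[of "nat (p mod 3)"] pow[of "nat (q mod 3)"] pow[of "nat (r mod 3)"] pow[of "nat (s mod 2)"]
      by (intro generate.eng) simp_all
    then show ?thesis by (simp add: E_mult twist_def sym_mod)
  qed
  then show "{E p q r s | p q r s. True} \<subseteq> L_group A S i (b1, b2, b3)"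
    unfolding L_group_generate by blast
qed

lemma L_group_perm_auts: "L_group A S i (b1, b2, b3) \<subseteq> perm_auts 4 A S 2"
proof -
  have "E p q r s \<in> perm_auts 4 A S 2" for p q r s
    using E_Aut[of p q r s] sym_permutes[of p q r s]
    unfolding perm_auts_def perm_unitaries_def perm_endo_def by blast
  then show ?thesis unfolding L_group_eq by blast
qed

section \<open>Triviality of intertwiners and faithfulness of the parametrisation\<close>

text \<open>This is \<open>intertwiner_rigid\<close> with j = i and f = \<open>rot_pow p\<close>,
  applied to two indices; the resulting equations are those that \<open>sym_parameters_zero\<close>
  asks for.\<close>

lemma intertwiner_trivial:
  assumes v: "v \<in> unitaries A" and vi: "v \<otimes> S i = E p q r s (S i) \<otimes> v"
    and x: "x \<in> {b1, b2, b3}" "x' \<in> {b1, b2, b3}" "x \<noteq> x'"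
    and vx: "\<And>z. z \<in> {x, x'} \<Longrightarrow> v \<otimes> S z = E p q r s (S z) \<otimes> v"
  shows "3 dvd p \<and> 3 dvd q \<and> 3 dvd r \<and> even s"
proof (rule sym_parameters_zero[OF x])
  fix z assume z: "z \<in> {x, x'}"
  then have zb: "z \<in> {b1, b2, b3}" using x by auto
  then have z4: "z \<in> {1..4}" by (auto simp only: index_iff insert_iff empty_iff)
  have zi: "z \<noteq> i" using zb by auto
  \<comment> \<open>The preimage of z under \<open>rot_pow p\<close>, as the rigidity theorem
    requires.\<close>
  define y where "y = rot_pow (- p) z"
  have fy: "rot_pow p y = z" by (simp add: y_def rot_pow_rot_pow)
  have y4: "y \<in> {1..4}" and yi: "y \<noteq> i"
    using z4 zi fixes_index_range[of "rot_pow (- p)"] fixes_index_iff[of "rot_pow (- p)"]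
    by (simp_all add: y_def)
  have s: "sym p q r s [x, y] = (if x = i then [i, rot_pow p y]
      else if y = i then [rot_pow q (flip_pow s x), i] else [flip_pow s x, rot_pow r y])"
    if "x \<in> {1..4}" "y \<in> {1..4}" for x y
    unfolding sym_def block_simps[OF that] by simp
  have row: "sym p q r s [i, w] = [i, rot_pow p w]" if "w \<in> {1..4}" for w
    using s[OF in_index(4) that] by simp
  have fi: "rot_pow p i = i"
    using fixes_index_iff[of "rot_pow p" i] by simp
  have ne: "flip_pow s z \<noteq> i" "rot_pow q (flip_pow s z) \<noteq> i"
    using zi fixes_index_iff[of "flip_pow s"] fixes_index_iff[of "rot_pow q"] by simp_all
  have off: "hd (sym p q r s [z, w]) \<noteq> i" if "w \<in> {1..4}" for w
    using s[OF z4 that] zi ne by simp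
  have rigid: "hd (sym p q r s [z, w]) = y" if "w \<in> {1..4}" for w
    by (rule intertwiner_rigid_fst[OF sym_permutes v in_index(4) vi row fi z4 vx[OF z] off y4 fy])
      (use that in auto)
  have swap: "sym p q r s [z, y] = [y, z]"
    by (rule intertwiner_rigid_swap[OF sym_permutes v in_index(4) vi row fi z4 vx[OF z] off y4 fy])
  \<comment> \<open>The words \<open>[z, i]\<close> and \<open>[z, z]\<close> yield the first letter
    in column i and in the block; the swap of z and y fixes the effect of r.\<close>
  have 1: "rot_pow q (flip_pow s z) = y" using rigid[OF in_index(4)] s[OF z4 in_index(4)] zi by simp
  have 2: "flip_pow s z = y" using rigid[OF z4] s[OF z4 z4] zi by simp
  have 3: "rot_pow r y = z" using swap s[OF z4 y4] zi yi by simp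
  show "rot_pow p (flip_pow s z) = z \<and> rot_pow q (flip_pow s z) = flip_pow s z \<and> rot_pow r (flip_pow s z) = z"
    using 1 2 3 fy by simp
qed

lemma inner_trivial:
  assumes w: "w \<in> unitaries A" and eq: "\<And>x. x \<in> {1..4} \<Longrightarrow> E p q r s (S x) = w \<otimes> S x \<otimes> star A w"
  shows "3 dvd p \<and> 3 dvd q \<and> 3 dvd r \<and> even s"
proof -
  have w': "w \<in> carrier A" "star A w \<otimes> w = \<one>" using w by (auto simp: unitaries_def)
  have *: "w \<otimes> S x = E p q r s (S x) \<otimes> w" if x: "x \<in> {1..4}" for x
    using eq[OF x] w' S_closed[OF x] by (simp add: m_assoc)
  show ?thesis
    by (rule intertwiner_trivial[OF w *[OF in_index(4)], of b1 b2])
      (use *[OF in_index(1)] *[OF in_index(2)] in auto)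
qed

lemma E_periodic:
  assumes "3 dvd p - p'" "3 dvd q - q'" "3 dvd r - r'" "2 dvd s - s'"
  shows "E p q r s = E p' q' r' s'"
proof -
  have eq: "p mod 3 = p' mod 3" "q mod 3 = q' mod 3" "r mod 3 = r' mod 3" "s mod 2 = s' mod 2"
    using assms by (simp_all only: mod_eq_dvd_iff)
  have "sym p q r s = sym (p mod 3) (q mod 3) (r mod 3) (s mod 2)" by (rule sym_mod[symmetric])
  also have "\<dots> = sym p' q' r' s'" unfolding eq by (rule sym_mod)
  finally show ?thesis by simp
qed

lemma E_inner:
  assumes "E p q r s \<in> cstar_Inn A"
  shows "3 dvd p \<and> 3 dvd q \<and> 3 dvd r \<and> even s"
proof -
  obtain w where "w \<in> unitaries A" "E p q r s = (\<lambda>x\<in>carrier A. w \<otimes> x \<otimes> star A w)"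
    using assms by (auto simp: cstar_Inn_def)
  then show ?thesis by (intro inner_trivial[of w]) simp_all
qed

text \<open>Composing with an inverse turns an equality into the identity, which is inner, so
  faithfulness is a case of \<open>E_inner\<close>.\<close>

lemma E_eq_iff:
  "E p q r s = E p' q' r' s' \<longleftrightarrow> 3 dvd p - p' \<and> 3 dvd q - q' \<and> 3 dvd r - r' \<and> 2 dvd s - s'"
proof
  assume eq: "E p q r s = E p' q' r' s'"
  have "E (- twist s' p' + twist s' p) (- twist s' q' + twist s' q) (- twist s' r' + twist s' r) (- s' + s)
      = compose (carrier A) (E (- twist s' p') (- twist s' q') (- twist s' r') (- s')) (E p q r s)"
    unfolding E_compose by (simp add: twist_def)
  also have "\<dots> \<in> cstar_Inn A" unfolding eq E_inverse by (rule one_in_cstar_Inn)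
  finally have "3 dvd - twist s' p' + twist s' p \<and> 3 dvd - twist s' q' + twist s' q
      \<and> 3 dvd - twist s' r' + twist s' r \<and> even (- s' + s)"
    by (rule E_inner)
  then show "3 dvd p - p' \<and> 3 dvd q - q' \<and> 3 dvd r - r' \<and> 2 dvd s - s'"
    unfolding twist_def by (cases "even s'") (simp_all, presburger+)
qed (use E_periodic in blast)

text \<open>An element over the trivial class is conjugation by a unitary, and
  \<open>inner_trivial\<close> then makes all its exponents trivial.\<close>

lemma kernel_L_group:
  "kernel (cstar_Aut A \<lparr>carrier := L_group A S i (b1, b2, b3)\<rparr>) (cstar_Out A) (out_proj A) =
    {\<one>\<^bsub>cstar_Aut A\<^esub>}"
proof -
  have "\<phi> = (\<lambda>x\<in>carrier A. x)"
    if L: "\<phi> \<in> L_group A S i (b1, b2, b3)" and out: "out_proj A \<phi> = cstar_Inn A" for \<phi>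
  proof -
    obtain p q r s where \<phi>: "\<phi> = E p q r s" using L unfolding L_group_eq by blast
    obtain w where w: "w \<in> unitaries A" "\<And>x. x \<in> carrier A \<Longrightarrow> \<phi> x = w \<otimes> (\<lambda>x\<in>carrier A. x) x \<otimes> star A w"
      using out_projD[OF _ id_Bij, of \<phi>] out out_proj_one E_Bij \<phi> by metis
    have "3 dvd p \<and> 3 dvd q \<and> 3 dvd r \<and> even s"
      using w by (intro inner_trivial[of w]) (simp_all add: \<phi>)
    then have "E p q r s = E 0 0 0 0" by (intro E_periodic) simp_all
    then show ?thesis by (simp add: \<phi> E_0)
  qed
  moreover have "(\<lambda>x\<in>carrier A. x) \<in> L_group A S i (b1, b2, b3)"
    unfolding L_group_eq E_0[symmetric] by blast
  moreover have "kernel (cstar_Aut A \<lparr>carrier := L_group A S i (b1, b2, b3)\<rparr>) (cstar_Out A) (out_proj A) =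
      {\<phi> \<in> L_group A S i (b1, b2, b3). out_proj A \<phi> = cstar_Inn A}"
    by (simp add: kernel_def cstar_Out_def FactGroup_def)
  ultimately show ?thesis unfolding one_cstar_Aut using out_proj_one by blast
qed

lemma L_group_iso:
  "cstar_Aut A \<lparr>carrier := L_group A S i (b1, b2, b3)\<rparr> \<cong>
    semidirect Z3_cubed (integer_mod_group 2) twisting"
proof (rule is_iso_if_inverse_hom)
  let ?H = "semidirect Z3_cubed (integer_mod_group 2) twisting"
  let ?h = "\<lambda>((p, q, r), s). E p q r s"
  have H: "carrier ?H = ({0..<3} \<times> {0..<3} \<times> {0..<3}) \<times> {0..<2}"
    by (simp add: semidirect_def carrier_integer_mod_group)
  have mult: "((p, q, r), s) \<otimes>\<^bsub>?H\<^esub> ((p', q', r'), s') =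
      (((p + twist s p') mod 3, (q + twist s q') mod 3, (r + twist s r') mod 3), (s + s') mod 2)"
    if "((p', q', r'), s') \<in> carrier ?H" for p q r s p' q' r' s'
    using that by (simp add: H semidirect_def twisting_simp carrier_integer_mod_group twist_def mod_simps)
  show "bij_betw ?h (carrier ?H) (carrier (cstar_Aut A \<lparr>carrier := L_group A S i (b1, b2, b3)\<rparr>))"
  proof (rule bij_betw_imageI)
    have eq: "x = y" if "m dvd x - y" "0 \<le> x" "x < m" "0 \<le> y" "y < m" for m x y :: int
      using that by (metis mod_eq_dvd_iff mod_pos_pos_trivial)
    have eq2: "x = y" if "even x \<longleftrightarrow> even y" "0 \<le> x" "x < 2" "0 \<le> y" "y < 2" for x y :: int
      using that by presburger
    show "inj_on ?h (carrier ?H)"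
      unfolding H by (rule inj_onI) (auto simp: E_eq_iff intro: eq eq2)
    have "E p q r s \<in> ?h ` carrier ?H" for p q r s
      unfolding H by (rule image_eqI[of _ _ "((p mod 3, q mod 3, r mod 3), s mod 2)"])
        (simp_all add: sym_mod)
    then show "?h ` carrier ?H = carrier (cstar_Aut A \<lparr>carrier := L_group A S i (b1, b2, b3)\<rparr>)"
      by (auto simp: L_group_eq)
  qed
  fix x y assume x: "x \<in> carrier ?H" and y: "y \<in> carrier ?H"
  obtain p q r s where x': "x = ((p, q, r), s)" by (metis surj_pair)
  obtain p' q' r' s' where y': "y = ((p', q', r'), s')" by (metis surj_pair)
  show "x \<otimes>\<^bsub>?H\<^esub> y \<in> carrier ?H"
    using y unfolding x' y' by (simp add: mult) (simp add: H)
  show "?h (x \<otimes>\<^bsub>?H\<^esub> y) = ?h x \<otimes>\<^bsub>cstar_Aut A\<lparr>carrier := L_group A S i (b1, b2, b3)\<rparr>\<^esub> ?h y"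
    using y unfolding x' y' by (simp add: mult E_mult sym_mod)
qed

text \<open>The permutation a moves only words that begin with i.\<close>

lemma E_1_fixes:
  assumes x: "x \<in> {1..4}" "x \<noteq> i"
  shows "E 1 0 0 0 (S x) = S x"
proof (rule cuntz_family_eqI[OF family])
  fix y :: nat assume y: "y \<in> {1..4}"
  have "sym 1 0 0 0 [x, y] = [x, y]"
    unfolding sym_def block_simps[OF x(1) y] using x(2) by (simp add: flip_pow_def)
  then show "E 1 0 0 0 (S x) \<otimes> S y = S x \<otimes> S y"
    using perm_endo_S_S[OF sym_permutes x(1) y] y by (simp add: W_Cons)
qed (use x perm_endo_closed[OF sym_permutes] in auto)

end

section \<open>Comparison of the groups for two indices\<close>

text \<open>Suppose lambda_a from L_i agrees with an element of L_j modulo inner automorphisms. The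
  adjoint of the connecting unitary then intertwines S_x for every x other than i, in particular for
  j and two of the remaining indices. Rigidity at j makes the element of L_j trivial, so lambda_a is
  inner, against rigidity at i.\<close>

lemma out_proj_L_group_neq:
  assumes "cuntz_triple i b1 b2 b3 A S" and "cuntz_triple j d1 d2 d3 A S" and ij: "i \<noteq> j"
  shows "out_proj A ` L_group A S i (b1, b2, b3) \<noteq> out_proj A ` L_group A S j (d1, d2, d3)"
proof
  interpret I: cuntz_triple i b1 b2 b3 A S by fact
  interpret J: cuntz_triple j d1 d2 d3 A S by fact
  assume "out_proj A ` L_group A S i (b1, b2, b3) = out_proj A ` L_group A S j (d1, d2, d3)"
  moreover have "I.E 1 0 0 0 \<in> L_group A S i (b1, b2, b3)" unfolding I.L_group_eq by blast
  ultimately have "out_proj A (I.E 1 0 0 0) \<in> out_proj A ` L_group A S j (d1, d2, d3)" by blast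
  then obtain p q r s where pq: "out_proj A (I.E 1 0 0 0) = out_proj A (J.E p q r s)"
    unfolding J.L_group_eq by blast
  obtain w where w: "w \<in> unitaries A" and
    eq: "\<And>x. x \<in> carrier A \<Longrightarrow> I.E 1 0 0 0 x = w \<otimes>\<^bsub>A\<^esub> J.E p q r s x \<otimes>\<^bsub>A\<^esub> star A w"
    using I.out_projD[OF I.E_Bij J.E_Bij pq] by blast
  have w': "w \<in> carrier A" "star A w \<otimes>\<^bsub>A\<^esub> w = \<one>\<^bsub>A\<^esub>" "w \<otimes>\<^bsub>A\<^esub> star A w = \<one>\<^bsub>A\<^esub>"
    using w by (auto simp: unitaries_def)
  have v: "star A w \<in> unitaries A" using w' I.star_star by (simp add: unitaries_def)
  have vS: "star A w \<otimes>\<^bsub>A\<^esub> S x = J.E p q r s (S x) \<otimes>\<^bsub>A\<^esub> star A w" if x: "x \<in> {1..4}" "x \<noteq> i" for x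
  proof -
    have Ex: "J.E p q r s (S x) \<in> carrier A" and Sx: "S x \<in> carrier A"
      using I.perm_endo_closed[OF J.sym_permutes] I.S_closed x by simp_all
    have "S x = w \<otimes>\<^bsub>A\<^esub> J.E p q r s (S x) \<otimes>\<^bsub>A\<^esub> star A w"
      using eq[OF Sx] I.E_1_fixes[OF x] by simp
    then have "star A w \<otimes>\<^bsub>A\<^esub> S x
        = star A w \<otimes>\<^bsub>A\<^esub> (w \<otimes>\<^bsub>A\<^esub> J.E p q r s (S x) \<otimes>\<^bsub>A\<^esub> star A w)"
      by (rule arg_cong[where f = "\<lambda>y. star A w \<otimes>\<^bsub>A\<^esub> y"])
    also have "\<dots> = (star A w \<otimes>\<^bsub>A\<^esub> w) \<otimes>\<^bsub>A\<^esub> J.E p q r s (S x) \<otimes>\<^bsub>A\<^esub> star A w"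
      using w'(1) Ex by (simp add: I.m_assoc)
    finally show ?thesis using w' Ex by simp
  qed
  \<comment> \<open>At most one of three distinct indices equals i, so two are left for
    \<open>J.intertwiner_trivial\<close>.\<close>
  obtain x x' where x: "x \<in> {d1, d2, d3}" "x' \<in> {d1, d2, d3}" "x \<noteq> x'" "x \<noteq> i" "x' \<noteq> i"
    using J.distinct by (metis insertI1 insertI2)
  have "3 dvd p \<and> 3 dvd q \<and> 3 dvd r \<and> even s"
  proof (rule J.intertwiner_trivial[OF v _ x(1-3)])
    show "star A w \<otimes>\<^bsub>A\<^esub> S j = J.E p q r s (S j) \<otimes>\<^bsub>A\<^esub> star A w"
      by (rule vS[OF J.i]) (use ij in simp)
    show "star A w \<otimes>\<^bsub>A\<^esub> S z = J.E p q r s (S z) \<otimes>\<^bsub>A\<^esub> star A w" if "z \<in> {x, x'}" for z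
      using that x J.index_iff[of z] by (intro vS) auto
  qed
  then have "J.E p q r s = (\<lambda>x\<in>carrier A. x)"
    using J.E_periodic[of p 0 q 0 r 0 s 0] J.E_0 by simp
  then have "I.E 1 0 0 0 (S x) = w \<otimes>\<^bsub>A\<^esub> S x \<otimes>\<^bsub>A\<^esub> star A w" if "x \<in> {1..4}" for x
    using eq[of "S x"] I.S_closed[OF that] by simp
  \<comment> \<open>The first exponent of lambda_a is 1, which would have to be divisible by
    3.\<close>
  then have "(3::int) dvd 1" using I.inner_trivial[OF w] by blast
  then show False by simp
qed

lemma cuntz_tripleI:
  assumes "cuntz_algebra 4 A S" "i \<in> {1..4}" "admissible i (b1, b2, b3)"
  shows "cuntz_triple i b1 b2 b3 A S"
  using assms by (intro cuntz_triple.intro index_triple.intro) (auto simp: admissible_def)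

theorem theorem5p9:
  fixes A :: "'a cstar" and S :: "nat \<Rightarrow> 'a" and b :: "nat \<Rightarrow> nat \<times> nat \<times> nat"
  assumes "cuntz_algebra 4 A S"
    and "\<forall>i\<in>{1..4}. admissible i (b i)"
  shows "(\<forall>i\<in>{1..4}.
        L_group A S i (b i) \<subseteq> perm_auts 4 A S 2 \<and>
        (\<exists>\<theta> \<in> hom (integer_mod_group 2) (AutoGroup Z3_cubed).
          cstar_Aut A \<lparr>carrier := L_group A S i (b i)\<rparr> \<cong>
            semidirect Z3_cubed (integer_mod_group 2) \<theta>) \<and>
        kernel (cstar_Aut A \<lparr>carrier := L_group A S i (b i)\<rparr>) (cstar_Out A) (out_proj A) =
          {\<one>\<^bsub>cstar_Aut A\<^esub>}) \<and>
      (\<forall>i\<in>{1..4}. \<forall>j\<in>{1..4}. i \<noteq> j \<longrightarrow>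
        out_proj A ` L_group A S i (b i) \<noteq> out_proj A ` L_group A S j (b j))"
proof -
  have triple: "\<exists>b1 b2 b3. b i = (b1, b2, b3) \<and> cuntz_triple i b1 b2 b3 A S" if "i \<in> {1..4}" for i
  proof -
    obtain b1 b2 b3 where "b i = (b1, b2, b3)" by (cases "b i")
    then show ?thesis using cuntz_tripleI[OF assms(1) that] bspec[OF assms(2) that] by simp
  qed
  show ?thesis
  proof (intro conjI ballI impI)
    fix i :: nat assume "i \<in> {1..4}"
    then obtain b1 b2 b3 where b: "b i = (b1, b2, b3)" and "cuntz_triple i b1 b2 b3 A S"
      using triple by blast
    then interpret cuntz_triple i b1 b2 b3 A S by simp
    show "L_group A S i (b i) \<subseteq> perm_auts 4 A S 2"
      unfolding b by (rule L_group_perm_auts)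
    show "\<exists>\<theta> \<in> hom (integer_mod_group 2) (AutoGroup Z3_cubed).
        cstar_Aut A \<lparr>carrier := L_group A S i (b i)\<rparr> \<cong>
          semidirect Z3_cubed (integer_mod_group 2) \<theta>"
      unfolding b using L_group_iso twisting_hom by blast
    show "kernel (cstar_Aut A \<lparr>carrier := L_group A S i (b i)\<rparr>) (cstar_Out A) (out_proj A) =
        {\<one>\<^bsub>cstar_Aut A\<^esub>}"
      unfolding b by (rule kernel_L_group)
  next
    fix i j :: nat assume "i \<in> {1..4}" "j \<in> {1..4}" and ij: "i \<noteq> j"
    then obtain b1 b2 b3 d1 d2 d3 where b: "b i = (b1, b2, b3)" "b j = (d1, d2, d3)"
      and "cuntz_triple i b1 b2 b3 A S" "cuntz_triple j d1 d2 d3 A S"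
      using triple by meson
    then show "out_proj A ` L_group A S i (b i) \<noteq> out_proj A ` L_group A S j (b j)"
      unfolding b using ij by (intro out_proj_L_group_neq)
  qed
qed

end
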